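(* Let $G$ be an irreducible finite Coxeter group or a Shephard group. The natural Saito structure $(\nabla,\ast,E)$ for $G$ admits a compatible Frobenius structure (i.e. there is a metric on $M$ which together with $(\nabla,\ast,E)$ forms a Frobenius structure of some charge $D$) if and only if $\nabla=\nabla^{cs}$. Moreover, a compatible metric is a constant multiple of $\eta$ and the charge is $D=1-\frac{d_n}{d_1}$.
   Context: **Setting.** Let $V=\mathbb{C}^n$ with standard coordinates $u^1,\dots,u^n$, and let $G\subset GL(V)$ be an irreducible finite complex reflection group which is a finite Coxeter group (complexification of a finite real reflection group) or a Shephard group (symmetry group of a regular complex polytope). A set of basic invariants $x^1,\dots,x^n$ is a set of homogeneous generators of $\mathbb{C}[V]^G$, ordered so that the degrees $d_\alpha=\deg x^\alpha$ are descending. For such $G$ it is known that $d_1>d_2>\dots>d_n\ge 2$ and $d_\alpha+d_{n+1-\alpha}=d_1+d_n$ for all $\alpha$. Let $M=\mathrm{Spec}\,\mathbb{C}[V]^G\cong\mathbb{C}^n$ be the orbit space with coordinates $x^1,\dots,x^n$, $\pi:V\to M$ the orbit map, $V^\circ\subset V$ the complement of the reflection hyperplanes and $M^\circ=\pi(V^\circ)$. Since $\pi:V^\circ\to M^\circ$ is an unbranched covering, $u^1,\dots,u^n$ are local coordinates on $M^\circ$. $\mathcal{T}$ denotes the sheaf of holomorphic vector fields. Put $$e=\frac{\partial}{\partial x^1},\qquad E=\frac1{d_1}\sum_i u^i\frac{\partial}{\partial u^i}=\frac1{d_1}\sum_\alpha d_\alpha x^\alpha\frac{\partial}{\partial x^\alpha}.$$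 **Saito structure.** A Saito structure (without metric) $(\nabla,\ast,E)$ on a manifold consists of a torsion-free flat connection $\nabla$ on the tangent bundle, an associative commutative multiplication $\ast$ on it with unit $e$, and a vector field $E$, with: $\nabla_X(Y\ast Z)-Y\ast\nabla_XZ-\nabla_Y(X\ast Z)+X\ast\nabla_YZ=[X,Y]\ast Z$; $[E,X\ast Y]-[E,X]\ast Y-X\ast[E,Y]=X\ast Y$; $\nabla e=0$; $\nabla_X\nabla_YE-\nabla_{\nabla_XY}E=0$. **Frobenius structure.** A Frobenius structure of charge $D\in\mathbb{C}$ is a Saito structure $(\nabla,\ast,E)$ together with a metric (nondegenerate symmetric bilinear form) $\eta$ on the tangent bundle with: $X(\eta(Y,Z))=\eta(\nabla_XY,Z)+\eta(Y,\nabla_XZ)$; $\eta(X\ast Y,Z)=\eta(X,Y\ast Z)$; $E\eta(X,Y)-\eta([E,X],Y)-\eta(X,[E,Y])=(2-D)\eta(X,Y)$. Such $\eta$ is called compatible with $(\nabla,\ast,E)$. **Natural Saito structure $(\nabla,\ast,E)$.** $\boldsymbol{\nabla}^V$ is the connection on $TM^\circ$ with $\boldsymbol{\nabla}^V_{\partial/\partial u^i}\frac{\partial}{\partial u^j}=0$. It is known that $X\mapsto\boldsymbol{\nabla}^V_Xe$ is invertible at every point of $M^\circ$; $\star$ is the multiplication on $TM^\circ$ uniquely determined by $\boldsymbol{\nabla}^V_X\boldsymbol{\nabla}^V_Ye-\boldsymbol{\nabla}^V_{\boldsymbol{\nabla}^V_XY}e+\boldsymbol{\nabla}^V_{X\star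 Y}e=0$. The endomorphism $e\star$ is invertible on $M^\circ$; define $e\star(X\ast Y)=X\star Y$ and $\nabla_XY=\boldsymbol{\nabla}^V_XY-\boldsymbol{\nabla}^V_{X\ast Y}e$. It is known that $(\nabla,\ast,E)$ is a Saito structure on $M^\circ$ that extends to $M$, with $\nabla$-flat coordinates $t^1,\dots,t^n$ that form a set of basic invariants and in which the structure constants of $\ast$ are polynomials. **The connection $\nabla^{cs}$ and metric $\eta$.** $h$ is the metric on $TM^\circ$ with $h(\frac{\partial}{\partial u^i},\frac{\partial}{\partial u^j})=\frac{\partial^2x^n}{\partial u^i\partial u^j}$ and $\boldsymbol{\nabla}^{cs}$ is its Levi-Civita connection. The map $X\mapsto\boldsymbol{\nabla}^{cs}_Xe$ is invertible at every point of $M^\circ$; $\diamond$ is the multiplication on $TM^\circ$ uniquely determined by $\boldsymbol{\nabla}^{cs}_X\boldsymbol{\nabla}^{cs}_Ye-\boldsymbol{\nabla}^{cs}_{\boldsymbol{\nabla}^{cs}_XY}e+\boldsymbol{\nabla}^{cs}_{X\diamond Y}e=0$. The endomorphism $e\diamond$ is invertible on $M^\circ$; define $$e\diamond(X\circledast Y)=X\diamond Y,\qquad \nabla^{cs}_XY=\boldsymbol{\nabla}^{cs}_XY-\boldsymbol{\nabla}^{cs}_{X\circledast Y}e,\qquad \eta(X,Y)=h(X,E\circledast Y).$$ These extend to $M$, and $(\eta,\circledast,E)$ with Levi-Civita connection $\nabla^{cs}$ is a Frobenius structure on $M$, called the Coxeter--Shephard Frobenius structure. *)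

theory Defs
  imports "HOL-Analysis.Analysis" "HOL-Algebra.Generated_Groups"
begin

section \<open>Reflection groups\<close>

definition general_linear_group :: "('a::field^'n^'n) monoid" where
  "general_linear_group = \<lparr>carrier = {A. invertible A}, mult = (**), one = mat 1\<rparr>"

definition fixed_space :: "'a::field^'n^'n \<Rightarrow> ('a^'n) set" where
  "fixed_space A = {v. A *v v = v}"

text \<open>Only applied to elements of finite groups, so finite order is automatic.\<close>

definition is_reflection :: "'a::field^'n^'n \<Rightarrow> bool" where
  "is_reflection A \<longleftrightarrow> A \<noteq> mat 1 \<and> vec.dim (fixed_space A) = CARD('n) - 1"

definition finite_reflection_group :: "('a::field^'n^'n) set \<Rightarrow> bool" where
  "finite_reflection_group G \<longleftrightarrow>
     finite G \<and> subgroup G general_linear_group \<and>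
     generate general_linear_group {A \<in> G. is_reflection A} = G"

text \<open>The trivial group on a line is not regarded as an irreducible reflection group.\<close>

definition irreducible_group :: "('a::field^'n^'n) set \<Rightarrow> bool" where
  "irreducible_group G \<longleftrightarrow> G \<noteq> {mat 1} \<and>
     (\<forall>W. vec.subspace W \<and> (\<forall>A\<in>G. \<forall>w\<in>W. A *v w \<in> W) \<longrightarrow> W = {0} \<or> W = UNIV)"

text \<open>The vector space \<open>V\<close> carries no preferred real or Hermitian structure. Hence Coxeter and
  Shephard groups, which are given in \<open>\<real>\<^sup>n\<close> and in unitary \<open>n\<close>-space, are
  transported to \<open>V\<close> by an arbitrary linear isomorphism \<open>P\<close>.\<close>

definition conjugate_set :: "'a::field^'n^'n \<Rightarrow> ('a^'n^'n) set \<Rightarrow> ('a^'n^'n) set" where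
  "conjugate_set P H = (\<lambda>A. P ** A ** matrix_inv P) ` H"

definition complexify :: "real^'n^'n \<Rightarrow> complex^'n^'n" where
  "complexify = map_matrix complex_of_real"

definition finite_coxeter_group :: "(complex^'n^'n) set \<Rightarrow> bool" where
  "finite_coxeter_group G \<longleftrightarrow>
     (\<exists>P H. invertible P \<and> finite_reflection_group H \<and> G = conjugate_set P (complexify ` H))"

section \<open>Regular complex polytopes and Shephard groups\<close>

text \<open>Complex affine subspaces; the empty set has dimension \<open>- 1\<close>.\<close>

definition complex_flat :: "int \<Rightarrow> (complex^'n) set \<Rightarrow> bool" where
  "complex_flat k F \<longleftrightarrow> (k = - 1 \<and> F = {}) \<or>
     (\<exists>a W. vec.subspace W \<and> k = int (vec.dim W) \<and> F = (+) a ` W)"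

text \<open>Following Shephard and Coxeter, a complex polytope is the finite set of its faces,
  including the empty face and the whole space, ordered by inclusion. The last
  condition is connectedness of all sections of rank at least two.\<close>

definition complex_polytope :: "(complex^'n) set set \<Rightarrow> bool" where
  "complex_polytope \<P> \<longleftrightarrow>
     finite \<P> \<and> {} \<in> \<P> \<and> UNIV \<in> \<P> \<and> (\<forall>F\<in>\<P>. \<exists>k. complex_flat k F) \<and>
     (\<forall>A\<in>\<P>. \<forall>B\<in>\<P>. \<forall>i j k.
        A \<subset> B \<and> complex_flat i A \<and> complex_flat j B \<and> i < k \<and> k < j \<longrightarrow>
        card {F\<in>\<P>. complex_flat k F \<and> A \<subset> F \<and> F \<subset> B} \<ge> 2) \<and>
     (\<forall>A\<in>\<P>. \<forall>B\<in>\<P>. \<forall>i j.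
        A \<subset> B \<and> complex_flat i A \<and> complex_flat j B \<and> i + 3 \<le> j \<longrightarrow>
        (let S = {F\<in>\<P>. A \<subset> F \<and> F \<subset> B} in
          \<forall>F\<in>S. \<forall>F'\<in>S. (F, F') \<in> {(X, Y). X \<in> S \<and> Y \<in> S \<and> (X \<subseteq> Y \<or> Y \<subseteq> X)}\<^sup>*))"

definition is_unitary :: "complex^'n^'n \<Rightarrow> bool" where
  "is_unitary A \<longleftrightarrow> (\<chi> i j. cnj (A $ j $ i)) ** A = mat 1"

definition polytope_symmetries :: "(complex^'n) set set \<Rightarrow> (complex^'n^'n) set" where
  "polytope_symmetries \<P> = {A. is_unitary A \<and> (\<lambda>F. (*v) A ` F) ` \<P> = \<P>}"

text \<open>Flags are the maximal chains of faces.\<close>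

definition regular_complex_polytope :: "(complex^'n) set set \<Rightarrow> bool" where
  "regular_complex_polytope \<P> \<longleftrightarrow> complex_polytope \<P> \<and>
     (\<forall>C C'. subset.maxchain \<P> C \<and> subset.maxchain \<P> C' \<longrightarrow>
        (\<exists>A\<in>polytope_symmetries \<P>. (\<lambda>F. (*v) A ` F) ` C = C'))"

definition shephard_group :: "(complex^'n^'n) set \<Rightarrow> bool" where
  "shephard_group G \<longleftrightarrow>
     (\<exists>P \<P>. invertible P \<and> regular_complex_polytope \<P> \<and>
        G = conjugate_set P (polytope_symmetries \<P>))"

section \<open>Basic invariants\<close>

inductive complex_polynomial_function :: "(complex^'n \<Rightarrow> complex) \<Rightarrow> bool" where
  const: "complex_polynomial_function (\<lambda>u. c)"
| coord: "complex_polynomial_function (\<lambda>u. u $ i)"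
| add: "complex_polynomial_function f \<Longrightarrow> complex_polynomial_function g \<Longrightarrow>
    complex_polynomial_function (\<lambda>u. f u + g u)"
| mult: "complex_polynomial_function f \<Longrightarrow> complex_polynomial_function g \<Longrightarrow>
    complex_polynomial_function (\<lambda>u. f u * g u)"

definition invariant_polynomial :: "(complex^'n^'n) set \<Rightarrow> (complex^'n \<Rightarrow> complex) \<Rightarrow> bool" where
  "invariant_polynomial G f \<longleftrightarrow>
     complex_polynomial_function f \<and> (\<forall>A\<in>G. \<forall>u. f (A *v u) = f u)"

text \<open>Degrees are only required to be weakly descending: the Coxeter groups of type \<open>D\<close> of
  even rank have a repeated degree.

  The index type is linearly ordered: \<open>1, \<dots>, n\<close> are the elements of \<open>'n\<close> in increasing
  order. The basic invariants are collected in the orbit map \<open>x\<close>, with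
  \<open>x\<^sup>\<alpha> = (\<lambda>u. x u $ \<alpha>)\<close> of degree \<open>d \<alpha>\<close>. It identifies the orbit space \<open>M\<close> with the type
  \<open>complex^'n\<close>, whose standard coordinates are then the \<open>x\<^sup>\<alpha>\<close>.\<close>

type_synonym 'n cvec = "(complex, 'n) vec"
type_synonym 'n cmat = "((complex, 'n) vec, 'n) vec"

abbreviation first_index :: "'n::{finite,linorder}" where
  "first_index \<equiv> Min UNIV"

abbreviation last_index :: "'n::{finite,linorder}" where
  "last_index \<equiv> Max UNIV"

definition basic_invariants ::
    "'n::{finite,linorder} cmat set \<Rightarrow> ('n cvec \<Rightarrow> 'n cvec) \<Rightarrow> ('n \<Rightarrow> nat) \<Rightarrow> bool" where
  "basic_invariants G x d \<longleftrightarrow>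
     (\<forall>\<alpha>. invariant_polynomial G (\<lambda>u. x u $ \<alpha>)) \<and>
     (\<forall>\<alpha> c u. x (c *s u) $ \<alpha> = c ^ d \<alpha> * x u $ \<alpha>) \<and>
     (\<forall>f. invariant_polynomial G f \<longrightarrow>
        (\<exists>p. complex_polynomial_function p \<and> f = (\<lambda>u. p (x u)))) \<and>
     antimono d"

definition regular_vectors :: "'n::finite cmat set \<Rightarrow> 'n cvec set" where
  "regular_vectors G = {u. \<forall>A\<in>G. is_reflection A \<longrightarrow> u \<notin> fixed_space A}"

section \<open>Holomorphic tensor calculus on open subsets of \<open>\<complex>\<^sup>n\<close>\<close>

definition holomorphic_fun_on :: "'n::finite cvec set \<Rightarrow> ('n cvec \<Rightarrow> complex) \<Rightarrow> bool" where
  "holomorphic_fun_on S f \<longleftrightarrow>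
     (\<forall>p\<in>S. \<exists>D. (f has_derivative D) (at p) \<and> (\<forall>c v. D (c *s v) = c * D v))"

definition vector_field_on :: "'n::finite cvec set \<Rightarrow> ('n cvec \<Rightarrow> 'n cvec) \<Rightarrow> bool" where
  "vector_field_on S X \<longleftrightarrow> (\<forall>i. holomorphic_fun_on S (\<lambda>p. X p $ i))"

definition lie_bracket ::
    "('n::finite cvec \<Rightarrow> 'n cvec) \<Rightarrow> ('n cvec \<Rightarrow> 'n cvec) \<Rightarrow> 'n cvec \<Rightarrow> 'n cvec" where
  "lie_bracket X Y p = frechet_derivative Y (at p) (X p) - frechet_derivative X (at p) (Y p)"

definition field_apply ::
    "('n::finite cvec \<Rightarrow> 'n cvec) \<Rightarrow> ('n cvec \<Rightarrow> complex) \<Rightarrow> 'n cvec \<Rightarrow> complex" where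
  "field_apply X f p = frechet_derivative f (at p) (X p)"

text \<open>A \<open>(2,1)\<close>-tensor. It serves both as a multiplication on the tangent bundle and, relative
  to the standard coordinate frame, as the Christoffel symbol
  \<open>\<nabla> = d + \<Gamma>\<close> of a connection.\<close>

type_synonym 'n tensor21 = "'n cvec \<Rightarrow> 'n cvec \<Rightarrow> 'n cvec \<Rightarrow> 'n cvec"

definition tensor21_on :: "'n::finite cvec set \<Rightarrow> 'n tensor21 \<Rightarrow> bool" where
  "tensor21_on S T \<longleftrightarrow>
     (\<forall>p\<in>S. \<forall>v. Vector_Spaces.linear (*s) (*s) (\<lambda>w. T p v w) \<and>
                Vector_Spaces.linear (*s) (*s) (\<lambda>w. T p w v)) \<and>
     (\<forall>v w. vector_field_on S (\<lambda>p. T p v w))"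

definition times_field ::
    "'n::finite tensor21 \<Rightarrow> ('n cvec \<Rightarrow> 'n cvec) \<Rightarrow> ('n cvec \<Rightarrow> 'n cvec)
      \<Rightarrow> 'n cvec \<Rightarrow> 'n cvec" where
  "times_field m X Y p = m p (X p) (Y p)"

definition cov_deriv ::
    "'n::finite tensor21 \<Rightarrow> ('n cvec \<Rightarrow> 'n cvec) \<Rightarrow> ('n cvec \<Rightarrow> 'n cvec)
      \<Rightarrow> 'n cvec \<Rightarrow> 'n cvec" where
  "cov_deriv \<Gamma> X Y p = frechet_derivative Y (at p) (X p) + \<Gamma> p (X p) (Y p)"

definition torsion_free_on :: "'n::finite cvec set \<Rightarrow> 'n tensor21 \<Rightarrow> bool" where
  "torsion_free_on S \<Gamma> \<longleftrightarrow>
     (\<forall>U X Y. open U \<and> U \<subseteq> S \<and> vector_field_on U X \<and> vector_field_on U Y \<longrightarrow>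
       (\<forall>p\<in>U. cov_deriv \<Gamma> X Y p - cov_deriv \<Gamma> Y X p = lie_bracket X Y p))"

definition flat_on :: "'n::finite cvec set \<Rightarrow> 'n tensor21 \<Rightarrow> bool" where
  "flat_on S \<Gamma> \<longleftrightarrow>
     (\<forall>U X Y Z. open U \<and> U \<subseteq> S \<and> vector_field_on U X \<and> vector_field_on U Y \<and>
        vector_field_on U Z \<longrightarrow>
       (\<forall>p\<in>U. cov_deriv \<Gamma> X (cov_deriv \<Gamma> Y Z) p - cov_deriv \<Gamma> Y (cov_deriv \<Gamma> X Z) p
               - cov_deriv \<Gamma> (lie_bracket X Y) Z p = 0))"

type_synonym 'n tensor20 = "'n cvec \<Rightarrow> 'n cvec \<Rightarrow> 'n cvec \<Rightarrow> complex"

definition metric_on :: "'n::finite cvec set \<Rightarrow> 'n tensor20 \<Rightarrow> bool" where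
  "metric_on S g \<longleftrightarrow>
     (\<forall>p\<in>S. \<forall>v. Vector_Spaces.linear (*s) (*) (\<lambda>w. g p v w)) \<and>
     (\<forall>p\<in>S. \<forall>v w. g p v w = g p w v) \<and>
     (\<forall>p\<in>S. \<forall>v. (\<forall>w. g p v w = 0) \<longrightarrow> v = 0) \<and>
     (\<forall>v w. holomorphic_fun_on S (\<lambda>p. g p v w))"

definition eval_metric ::
    "'n::finite tensor20 \<Rightarrow> ('n cvec \<Rightarrow> 'n cvec) \<Rightarrow> ('n cvec \<Rightarrow> 'n cvec)
      \<Rightarrow> 'n cvec \<Rightarrow> complex" where
  "eval_metric g X Y p = g p (X p) (Y p)"

definition metric_connection_on :: "'n::finite cvec set \<Rightarrow> 'n tensor20 \<Rightarrow> 'n tensor21 \<Rightarrow> bool" where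
  "metric_connection_on S g \<Gamma> \<longleftrightarrow>
     (\<forall>U X Y Z. open U \<and> U \<subseteq> S \<and> vector_field_on U X \<and> vector_field_on U Y \<and>
        vector_field_on U Z \<longrightarrow>
       (\<forall>p\<in>U. field_apply X (eval_metric g Y Z) p =
          eval_metric g (cov_deriv \<Gamma> X Y) Z p + eval_metric g Y (cov_deriv \<Gamma> X Z) p))"

definition levi_civita_on :: "'n::finite cvec set \<Rightarrow> 'n tensor20 \<Rightarrow> 'n tensor21 \<Rightarrow> bool" where
  "levi_civita_on S g \<Gamma> \<longleftrightarrow>
     tensor21_on S \<Gamma> \<and> torsion_free_on S \<Gamma> \<and> metric_connection_on S g \<Gamma>"

section \<open>Saito and Frobenius structures\<close>

definition saito_structure_on ::
    "'n::finite cvec set \<Rightarrow> 'n tensor21 \<Rightarrow> 'n tensor21 \<Rightarrow> ('n cvec \<Rightarrow> 'n cvec)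
      \<Rightarrow> ('n cvec \<Rightarrow> 'n cvec) \<Rightarrow> bool" where
  "saito_structure_on S \<Gamma> m e E \<longleftrightarrow>
     tensor21_on S \<Gamma> \<and> torsion_free_on S \<Gamma> \<and> flat_on S \<Gamma> \<and>
     tensor21_on S m \<and>
     (\<forall>p\<in>S. \<forall>v w z. m p (m p v w) z = m p v (m p w z)) \<and>
     (\<forall>p\<in>S. \<forall>v w. m p v w = m p w v) \<and>
     vector_field_on S e \<and> (\<forall>p\<in>S. \<forall>v. m p (e p) v = v) \<and>
     vector_field_on S E \<and>
     (\<forall>U X Y Z. open U \<and> U \<subseteq> S \<and> vector_field_on U X \<and> vector_field_on U Y \<and>
        vector_field_on U Z \<longrightarrow>
       (\<forall>p\<in>U.
          cov_deriv \<Gamma> X (times_field m Y Z) p - times_field m Y (cov_deriv \<Gamma> X Z) p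
            - cov_deriv \<Gamma> Y (times_field m X Z) p + times_field m X (cov_deriv \<Gamma> Y Z) p
            = times_field m (lie_bracket X Y) Z p \<and>
          lie_bracket E (times_field m X Y) p - times_field m (lie_bracket E X) Y p
            - times_field m X (lie_bracket E Y) p = times_field m X Y p \<and>
          cov_deriv \<Gamma> X e p = 0 \<and>
          cov_deriv \<Gamma> X (cov_deriv \<Gamma> Y E) p - cov_deriv \<Gamma> (cov_deriv \<Gamma> X Y) E p = 0))"

definition frobenius_structure_on ::
    "'n::finite cvec set \<Rightarrow> 'n tensor21 \<Rightarrow> 'n tensor21 \<Rightarrow> ('n cvec \<Rightarrow> 'n cvec)
      \<Rightarrow> ('n cvec \<Rightarrow> 'n cvec) \<Rightarrow> complex \<Rightarrow> 'n tensor20 \<Rightarrow> bool" where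
  "frobenius_structure_on S \<Gamma> m e E D g \<longleftrightarrow>
     saito_structure_on S \<Gamma> m e E \<and> metric_on S g \<and> metric_connection_on S g \<Gamma> \<and>
     (\<forall>U X Y Z. open U \<and> U \<subseteq> S \<and> vector_field_on U X \<and> vector_field_on U Y \<and>
        vector_field_on U Z \<longrightarrow>
       (\<forall>p\<in>U.
          eval_metric g (times_field m X Y) Z p = eval_metric g X (times_field m Y Z) p \<and>
          field_apply E (eval_metric g X Y) p - eval_metric g (lie_bracket E X) Y p
            - eval_metric g X (lie_bracket E Y) p = (2 - D) * eval_metric g X Y p))"

section \<open>The two structures on the orbit space\<close>

text \<open>The field \<open>e = \<partial>/\<partial>x\<^sup>1\<close>. It is independent of the choice of basic invariants, up to a
  constant factor, exactly when \<open>d\<^sub>1\<close> is strictly larger than all other degrees.\<close>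

definition unit_field :: "'n::{finite,linorder} cvec \<Rightarrow> 'n cvec" where
  "unit_field p = axis first_index 1"

definition euler_field :: "('n::{finite,linorder} \<Rightarrow> nat) \<Rightarrow> 'n cvec \<Rightarrow> 'n cvec" where
  "euler_field d p = (\<chi> \<alpha>. of_nat (d \<alpha>) / of_nat (d first_index) * p $ \<alpha>)"

text \<open>The vector field \<open>\<partial>/\<partial>u\<^sup>j\<close> on \<open>x ` U\<close>, where \<open>U\<close> is an open set on which the orbit map is
  injective, so that the \<open>u\<^sup>i\<close> are coordinates on \<open>x ` U\<close>.\<close>

definition coord_field ::
    "('n::finite cvec \<Rightarrow> 'n cvec) \<Rightarrow> 'n cvec set \<Rightarrow> 'n \<Rightarrow> 'n cvec \<Rightarrow> 'n cvec" where
  "coord_field x U j p = frechet_derivative x (at (inv_into U x p)) (axis j 1)"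

definition linear_connection_on_orbits ::
    "'n::finite cmat set \<Rightarrow> ('n cvec \<Rightarrow> 'n cvec) \<Rightarrow> 'n tensor21 \<Rightarrow> bool" where
  "linear_connection_on_orbits G x \<Gamma> \<longleftrightarrow>
     tensor21_on (x ` regular_vectors G) \<Gamma> \<and>
     (\<forall>U i j. open U \<and> U \<subseteq> regular_vectors G \<and> inj_on x U \<longrightarrow>
        (\<forall>p\<in>x ` U. cov_deriv \<Gamma> (coord_field x U i) (coord_field x U j) p = 0))"

definition partial_deriv :: "'n::finite \<Rightarrow> ('n cvec \<Rightarrow> complex) \<Rightarrow> 'n cvec \<Rightarrow> complex" where
  "partial_deriv j f u = frechet_derivative f (at u) (axis j 1)"

definition hessian_metric ::
    "'n::{finite,linorder} cmat set \<Rightarrow> ('n cvec \<Rightarrow> 'n cvec) \<Rightarrow> 'n tensor20 \<Rightarrow> bool" where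
  "hessian_metric G x h \<longleftrightarrow>
     metric_on (x ` regular_vectors G) h \<and>
     (\<forall>U i j. open U \<and> U \<subseteq> regular_vectors G \<and> inj_on x U \<longrightarrow>
        (\<forall>u\<in>U. h (x u) (coord_field x U i (x u)) (coord_field x U j (x u)) =
           partial_deriv i (partial_deriv j (\<lambda>v. x v $ last_index)) u))"

text \<open>The passage from a connection \<open>\<Gamma>'\<close> (\<open>\<^bold>\<nabla>\<close> in the literature, playing the role of the dual
  connection) to the pair \<open>(\<Gamma>, m)\<close>, via the intermediate multiplication \<open>star\<close>.
  It is used for both structures.\<close>

definition obtained_by_duality_on ::
    "'n::finite cvec set \<Rightarrow> 'n tensor21 \<Rightarrow> ('n cvec \<Rightarrow> 'n cvec)
      \<Rightarrow> 'n tensor21 \<Rightarrow> 'n tensor21 \<Rightarrow> bool" where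
  "obtained_by_duality_on S \<Gamma>' e \<Gamma> m \<longleftrightarrow>
     (\<forall>p\<in>S. bij (\<lambda>v. cov_deriv \<Gamma>' (\<lambda>_. v) e p)) \<and>
     (\<exists>star. tensor21_on S star \<and>
        (\<forall>U X Y. open U \<and> U \<subseteq> S \<and> vector_field_on U X \<and> vector_field_on U Y \<longrightarrow>
          (\<forall>p\<in>U. cov_deriv \<Gamma>' X (cov_deriv \<Gamma>' Y e) p - cov_deriv \<Gamma>' (cov_deriv \<Gamma>' X Y) e p
                   + cov_deriv \<Gamma>' (times_field star X Y) e p = 0)) \<and>
        (\<forall>p\<in>S. bij (star p (e p))) \<and>
        (\<forall>p\<in>S. \<forall>v w. star p (e p) (m p v w) = star p v w) \<and>
        (\<forall>U X Y. open U \<and> U \<subseteq> S \<and> vector_field_on U X \<and> vector_field_on U Y \<longrightarrow>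
          (\<forall>p\<in>U. cov_deriv \<Gamma> X Y p =
             cov_deriv \<Gamma>' X Y p - cov_deriv \<Gamma>' (times_field m X Y) e p)))"

text \<open>The construction takes place on the dense open subset \<open>x ` regular_vectors G\<close> of \<open>M\<close>. The
  structures themselves are the holomorphic extensions to all of \<open>M\<close>; these are Saito and
  Frobenius structures, and density makes them unique.\<close>

definition natural_saito_structure ::
    "'n::{finite,linorder} cmat set \<Rightarrow> ('n cvec \<Rightarrow> 'n cvec) \<Rightarrow> ('n \<Rightarrow> nat)
      \<Rightarrow> 'n tensor21 \<Rightarrow> 'n tensor21 \<Rightarrow> bool" where
  "natural_saito_structure G x d \<Gamma> m \<longleftrightarrow>
     saito_structure_on UNIV \<Gamma> m unit_field (euler_field d) \<and>
     (\<exists>\<Gamma>V. linear_connection_on_orbits G x \<Gamma>V \<and>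
        obtained_by_duality_on (x ` regular_vectors G) \<Gamma>V unit_field \<Gamma> m)"

definition coxeter_shephard_frobenius_structure ::
    "'n::{finite,linorder} cmat set \<Rightarrow> ('n cvec \<Rightarrow> 'n cvec) \<Rightarrow> ('n \<Rightarrow> nat)
      \<Rightarrow> 'n tensor21 \<Rightarrow> 'n tensor21 \<Rightarrow> 'n tensor20 \<Rightarrow> bool" where
  "coxeter_shephard_frobenius_structure G x d \<Gamma> m g \<longleftrightarrow>
     (\<exists>D. frobenius_structure_on UNIV \<Gamma> m unit_field (euler_field d) D g) \<and>
     (\<exists>h \<Gamma>h. hessian_metric G x h \<and> levi_civita_on (x ` regular_vectors G) h \<Gamma>h \<and>
        obtained_by_duality_on (x ` regular_vectors G) \<Gamma>h unit_field \<Gamma> m \<and>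
        (\<forall>p\<in>x ` regular_vectors G. \<forall>v w. g p v w = h p v (m p (euler_field d p) w)))"

end

theory Submission
  imports Defs "HOL-Complex_Analysis.Conformal_Mappings"
begin

text \<open>Let \<open>g\<close> be a Frobenius metric compatible with a Saito structure \<open>(\<nabla>, \<^bold>*, E)\<close> on the orbit space.
  Homogeneity and nondegeneracy at the origin force the charge, and force \<open>g(e, _)\<close> to be a constant
  multiple of \<open>dx\<^sup>n\<close>; hence \<open>g(v, w)\<close> is a multiple of \<open>dx\<^sup>n(v \<^bold>* w)\<close>, and \<open>dx\<^sup>n\<close> is \<open>\<nabla>\<close>-flat.
  If \<open>dx\<^sup>n\<close> is flat for the natural connection, then duality and Euler's identity give
  \<open>h(E \<^bold>* v, w) = \<kappa> dx\<^sup>n(v \<^bold>* w)\<close> for the Hessian metric \<open>h\<close> of \<open>x\<^sup>n\<close>. This has the same form as the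
  defining property \<open>h(E \<^bold>\<circ> v, w) = \<eta>(v, w)\<close> of \<open>\<eta>\<close>, whose right-hand side is a multiple of
  \<open>dx\<^sup>n(v \<^bold>\<circ> w)\<close>. Neither multiplication depends on \<open>x\<^sup>1\<close>, so both multiplications by \<open>E\<close> are affine in
  \<open>x\<^sup>1\<close> with slope the identity; as \<open>h\<close> is nondegenerate, they coincide. Therefore
  \<open>\<eta>(v, w) = \<kappa> dx\<^sup>n(v \<^bold>* w)\<close>, first on a small open set and then everywhere by the identity theorem.
  If \<open>g\<close> exists, \<open>\<eta>\<close> is thus a multiple of \<open>g\<close>, and the two metrics share their Levi-Civita connection.
  If \<open>\<nabla> = \<nabla>\<^sup>c\<^sup>s\<close>, flatness of \<open>dx\<^sup>n\<close> is inherited from \<open>\<eta>\<close>, and \<open>\<eta>\<close> itself is compatible.\<close>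

section \<open>Polynomial functions and hyperplanes\<close>

lemma has_derivative_vecI:
  fixes f :: "'a::real_normed_vector \<Rightarrow> 'b::euclidean_space^'n::finite"
  assumes "\<And>i. ((\<lambda>u. f u $ i) has_derivative (\<lambda>v. D v $ i)) (at u within S)"
  shows "(f has_derivative D) (at u within S)"
  by (subst has_derivative_componentwise_within)
    (auto simp: Basis_vec_def inner_axis intro!: has_derivative_inner_left assms)

text \<open>All three properties follow from the sum and product rules in one induction. That
  directional derivatives are again polynomial makes the second derivatives in the Hessian of
  \<open>x\<close> available.\<close>

lemma complex_polynomial_function_derivative:
  assumes "complex_polynomial_function f"
  shows "\<exists>D. (\<forall>u. (f has_derivative D u) (at u)) \<and> (\<forall>u c v. D u (c *s v) = c * D u v) \<and>
    (\<forall>v. complex_polynomial_function (\<lambda>u. D u v))"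
  using assms
proof induction
  case (const c)
  then show ?case
    by (intro exI[of _ "\<lambda>u v. 0"]) (auto intro: complex_polynomial_function.const)
next
  case (coord i)
  then show ?case
    by (intro exI[of _ "\<lambda>u v. v $ i"])
      (auto intro!: complex_polynomial_function.const bounded_linear_imp_has_derivative)
next
  case (add f g)
  then obtain D D' where
    "(\<forall>u. (f has_derivative D u) (at u)) \<and> (\<forall>u c v. D u (c *s v) = c * D u v) \<and>
      (\<forall>v. complex_polynomial_function (\<lambda>u. D u v))"
    "(\<forall>u. (g has_derivative D' u) (at u)) \<and> (\<forall>u c v. D' u (c *s v) = c * D' u v) \<and>
      (\<forall>v. complex_polynomial_function (\<lambda>u. D' u v))"
    by blast
  then show ?case
    by (intro exI[of _ "\<lambda>u v. D u v + D' u v"])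
      (auto intro!: complex_polynomial_function.add derivative_eq_intros simp: algebra_simps)
next
  case (mult f g)
  then obtain D D' where
    D: "(\<forall>u. (f has_derivative D u) (at u)) \<and> (\<forall>u c v. D u (c *s v) = c * D u v) \<and>
      (\<forall>v. complex_polynomial_function (\<lambda>u. D u v))"
    and D': "(\<forall>u. (g has_derivative D' u) (at u)) \<and> (\<forall>u c v. D' u (c *s v) = c * D' u v) \<and>
      (\<forall>v. complex_polynomial_function (\<lambda>u. D' u v))"
    by blast
  have "((\<lambda>u. f u * g u) has_derivative (\<lambda>v. f u * D' u v + D u v * g u)) (at u)" for u
    using D D' by (intro has_derivative_mult) auto
  with mult.hyps D D' show ?case
    by (intro exI[of _ "\<lambda>u v. f u * D' u v + D u v * g u"])
      (auto intro!: complex_polynomial_function.add complex_polynomial_function.mult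
        simp: algebra_simps)
qed

lemma complex_polynomial_function_has_derivative:
  assumes "complex_polynomial_function f"
  shows "(f has_derivative frechet_derivative f (at u)) (at u)"
  using complex_polynomial_function_derivative[OF assms]
  by (auto simp: differentiable_def simp flip: frechet_derivative_works)

lemma complex_polynomial_function_frechet_scale:
  assumes "complex_polynomial_function f"
  shows "frechet_derivative f (at u) (c *s v) = c * frechet_derivative f (at u) v"
  using complex_polynomial_function_derivative[OF assms] frechet_derivative_at by metis

lemma complex_polynomial_function_frechet:
  assumes "complex_polynomial_function f"
  shows "complex_polynomial_function (\<lambda>u. frechet_derivative f (at u) v)"
proof -
  obtain D where D: "\<forall>u. (f has_derivative D u) (at u)" "complex_polynomial_function (\<lambda>u. D u v)"
    using complex_polynomial_function_derivative[OF assms] by blast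
  then have "D u = frechet_derivative f (at u)" for u
    using frechet_derivative_at by blast
  with D(2) show ?thesis by simp
qed

lemma complex_polynomial_function_sum:
  "(\<And>i. i \<in> I \<Longrightarrow> complex_polynomial_function (f i)) \<Longrightarrow>
    complex_polynomial_function (\<lambda>u. \<Sum>i\<in>I. f i u)"
  by (induction I rule: infinite_finite_induct)
    (auto intro: complex_polynomial_function.intros)

lemma complex_polynomial_function_prod:
  "(\<And>i. i \<in> I \<Longrightarrow> complex_polynomial_function (f i)) \<Longrightarrow>
    complex_polynomial_function (\<lambda>u. \<Prod>i\<in>I. f i u)"
  by (induction I rule: infinite_finite_induct)
    (auto intro: complex_polynomial_function.intros)

lemma complex_polynomial_map_has_derivative:
  fixes x :: "complex^'n::finite \<Rightarrow> complex^'m::finite"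
  assumes "\<And>\<alpha>. complex_polynomial_function (\<lambda>u. x u $ \<alpha>)"
  shows "(x has_derivative frechet_derivative x (at u)) (at u)"
    and "frechet_derivative x (at u) v $ \<alpha> = frechet_derivative (\<lambda>u. x u $ \<alpha>) (at u) v"
proof -
  have *: "(x has_derivative (\<lambda>v. \<chi> \<alpha>. frechet_derivative (\<lambda>u. x u $ \<alpha>) (at u) v)) (at u)"
    by (rule has_derivative_vecI)
      (use assms in \<open>auto intro: complex_polynomial_function_has_derivative\<close>)
  then show "(x has_derivative frechet_derivative x (at u)) (at u)"
    by (metis frechet_derivative_at)
  show "frechet_derivative x (at u) v $ \<alpha> = frechet_derivative (\<lambda>u. x u $ \<alpha>) (at u) v"
    using frechet_derivative_at[OF *] by (metis vec_lambda_beta)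
qed

lemma complex_polynomial_map_frechet_linear:
  fixes x :: "complex^'n::finite \<Rightarrow> complex^'m::finite"
  assumes "\<And>\<alpha>. complex_polynomial_function (\<lambda>u. x u $ \<alpha>)"
  shows "Vector_Spaces.linear (*s) (*s) (frechet_derivative x (at u))"
  using has_derivative_linear[OF complex_polynomial_map_has_derivative(1)[OF assms]]
  by (auto simp: vec_eq_iff complex_polynomial_map_has_derivative(2)[OF assms]
      complex_polynomial_function_frechet_scale[OF assms] linear_add
      intro!: Vector_Spaces.linear.intro module_hom.intro vec.module_axioms
        vec.vector_space_axioms module_hom_axioms.intro)

text \<open>If \<open>v\<close> avoids the other subspaces but lies in \<open>S\<close>, choose
  \<open>w\<close> outside \<open>S\<close>. The line \<open>w + t *s v\<close> misses
  \<open>S\<close> altogether and meets each other subspace at most once, since two meeting points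
  would put \<open>v\<close> into it. The field is infinite, so some \<open>t\<close> works.\<close>

lemma subspaces_union_not_UNIV:
  fixes \<S> :: "(complex^'n::finite) set set"
  assumes "finite \<S>" "\<And>S. S \<in> \<S> \<Longrightarrow> vec.subspace S \<and> S \<noteq> UNIV"
  shows "\<exists>v. \<forall>S\<in>\<S>. v \<notin> S"
  using assms
proof (induction \<S> rule: finite_induct)
  case (insert S \<S>)
  then obtain v where v: "\<forall>T\<in>\<S>. v \<notin> T" by auto
  obtain w where w: "w \<notin> S" using insert.prems by auto
  show ?case
  proof (cases "v \<in> S")
    case True
    have uniq: "s = t" if "T \<in> \<S>" "w + s *s v \<in> T" "w + t *s v \<in> T" for s t T
    proof (rule ccontr)
      assume "s \<noteq> t"
      have T: "vec.subspace T" using insert.prems that by auto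
      have "(1 / (s - t)) *s ((w + s *s v) - (w + t *s v)) \<in> T"
        using T that by (intro vec.subspace_scale vec.subspace_diff)
      also have "(w + s *s v) - (w + t *s v) = (s - t) *s v"
        by (simp add: vec_eq_iff algebra_simps)
      also have "(1 / (s - t)) *s ((s - t) *s v) = v"
        using \<open>s \<noteq> t\<close> by (simp only: vector_smult_assoc) simp
      finally show False using v that(1) by simp
    qed
    have "finite {t. \<exists>T\<in>\<S>. w + t *s v \<in> T}"
    proof -
      have "finite {t. w + t *s v \<in> T}" if "T \<in> \<S>" for T
      proof (cases "{t. w + t *s v \<in> T} = {}")
        case False
        then obtain s where s: "w + s *s v \<in> T" by blast
        have "{t. w + t *s v \<in> T} \<subseteq> {s}"
          using uniq[OF that _ s] by blast
        then show ?thesis by (rule finite_subset) simp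
      next
        case True
        then show ?thesis by (simp only: finite.emptyI)
      qed
      then show ?thesis using insert.hyps(1) by simp
    qed
    then obtain t where t: "\<forall>T\<in>\<S>. w + t *s v \<notin> T"
      using ex_new_if_finite[OF infinite_UNIV_char_0, of "{t::complex. \<exists>T\<in>\<S>. w + t *s v \<in> T}"] by auto
    have "w + t *s v \<notin> S"
    proof
      assume a: "w + t *s v \<in> S"
      have "(w + t *s v) - t *s v \<in> S"
        using insert.prems True a by (intro vec.subspace_diff vec.subspace_scale) auto
      then show False using w by simp
    qed
    with t show ?thesis by auto
  qed (use v in auto)
qed auto

text \<open>The linear forms killing a fixed nonzero vector are a proper subspace of the dual space,
  and finitely many of these do not cover it.\<close>

lemma complex_hyperplanes_avoid:
  fixes W :: "(complex^'n::finite) set"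
  assumes "finite W" "0 \<notin> W"
  shows "\<exists>l. \<forall>w\<in>W. (\<Sum>i\<in>UNIV. l $ i * w $ i) \<noteq> 0"
proof -
  define H where "H w = {l::complex^'n. (\<Sum>i\<in>UNIV. l $ i * w $ i) = 0}" for w
  have "\<exists>v. \<forall>S\<in>H ` W. v \<notin> S"
  proof (rule subspaces_union_not_UNIV)
    fix S assume "S \<in> H ` W"
    then obtain w where w: "w \<in> W" "S = H w" by auto
    then obtain i where i: "w $ i \<noteq> 0" using assms by (metis vec_eq_iff zero_index)
    have "axis i 1 \<notin> H w"
      using i by (auto simp: H_def axis_def if_distrib[of "\<lambda>x. x * _"] cong: if_cong)
    moreover have "vec.subspace (H w)"
      by (auto simp: vec.subspace_def H_def algebra_simps sum.distrib simp flip: sum_distrib_left)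
    ultimately show "vec.subspace S \<and> S \<noteq> UNIV" using w by auto
  qed (use assms in auto)
  then show ?thesis by (auto simp: H_def)
qed

section \<open>Local charts of the orbit map\<close>

lemma subgroup_general_linear_groupD:
  assumes "subgroup G general_linear_group"
  shows "A \<in> G \<Longrightarrow> invertible A" "mat 1 \<in> G" "A \<in> G \<Longrightarrow> B \<in> G \<Longrightarrow> A ** B \<in> G"
  using subgroup.subset[OF assms] subgroup.one_closed[OF assms] subgroup.m_closed[OF assms]
  by (auto simp: general_linear_group_def)

lemma invertible_matrix_mult_right_cancel:
  fixes A B C :: "'a::field^'n^'n"
  assumes "invertible B" "A ** B = C ** B"
  shows "A = C"
proof -
  obtain B' where "B ** B' = mat 1"
    using assms(1) by (auto simp: invertible_def)
  then show ?thesis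
    using assms(2) by (metis matrix_mul_assoc matrix_mul_rid)
qed

text \<open>A linear form \<open>l\<close> gives the invariant \<open>\<Prod>A\<in>G. (l u\<^sub>0 - l (A u))\<close>, a polynomial in \<open>x\<close>.
  Its differential at \<open>u\<^sub>0\<close> is a multiple of \<open>l\<close>, nonzero if \<open>l\<close> separates \<open>u\<^sub>0\<close> from the rest
  of its orbit; hence \<open>l\<close> vanishes on the kernel of the differential of \<open>x\<close>.\<close>

lemma orbit_map_derivative_injective:
  fixes x :: "'n::{finite,linorder} cvec \<Rightarrow> 'n cvec"
  assumes G: "finite G" "subgroup G general_linear_group"
    and x: "basic_invariants G x d"
    and u0: "\<And>A. A \<in> G \<Longrightarrow> A \<noteq> mat 1 \<Longrightarrow> A *v u0 \<noteq> u0"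
    and v: "frechet_derivative x (at u0) v = 0"
  shows "v = 0"
proof (rule ccontr)
  assume "v \<noteq> 0"
  \<comment> \<open>Nonvanishing of the form on the differences makes \<open>R u0\<close> nonzero;
    nonvanishing on \<open>v\<close> is what the differential of \<open>F\<close> will
    contradict.\<close>
  define W where "W = insert v ((\<lambda>A. u0 - A *v u0) ` (G - {mat 1}))"
  have "0 \<notin> W"
  proof
    assume "0 \<in> W"
    then have "0 \<in> (\<lambda>A. u0 - A *v u0) ` (G - {mat 1})"
      using \<open>v \<noteq> 0\<close> by (simp add: W_def)
    then obtain A where "0 = u0 - A *v u0" "A \<in> G - {mat 1}" by (rule imageE)
    then show False using u0[of A] by simp
  qed
  moreover have "finite W" using G(1) by (simp add: W_def)
  ultimately obtain l where l: "\<forall>w\<in>W. (\<Sum>i\<in>UNIV. l $ i * w $ i) \<noteq> 0"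
    using complex_hyperplanes_avoid[of W] by auto
  define L where "L w = (\<Sum>i\<in>UNIV. l $ i * w $ i)" for w
  have L_diff: "L (a - b) = L a - L b" for a b
    by (simp add: L_def algebra_simps sum_subtractf)
  have L_poly: "complex_polynomial_function (\<lambda>u. L u0 - L (A *v u))" for A
  proof -
    have "L u0 - L (A *v u) = L u0 + (\<Sum>i\<in>UNIV. \<Sum>j\<in>UNIV. (- l $ i * A $ i $ j) * u $ j)" for u
      by (simp add: L_def matrix_vector_mult_def sum_distrib_left sum_negf mult.assoc)
    then show ?thesis
      by (simp only:) (intro complex_polynomial_function_sum complex_polynomial_function.intros)
  qed
  define F where "F u = (\<Prod>A\<in>G. L u0 - L (A *v u))" for u
  define R where "R u = (\<Prod>A\<in>G - {mat 1}. L u0 - L (A *v u))" for u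
  have F: "F u = (L u0 - L u) * R u" for u
    unfolding F_def R_def
    by (subst prod.remove[of _ "mat 1"]) (use G subgroup_general_linear_groupD(2) in auto)
  have "F (B *v u) = F u" if B: "B \<in> G" for B u
  proof -
    \<comment> \<open>Right multiplication by \<open>B\<close> permutes the finite group, so it only
      reorders the factors of \<open>F\<close>.\<close>
    have "inj_on (\<lambda>A. A ** B) G"
      using invertible_matrix_mult_right_cancel[OF subgroup_general_linear_groupD(1)[OF G(2) B]]
      by (auto simp: inj_on_def)
    moreover have "(\<lambda>A. A ** B) ` G \<subseteq> G"
      using subgroup_general_linear_groupD(3)[OF G(2)] B by auto
    ultimately have "bij_betw (\<lambda>A. A ** B) G G"
      using G(1) by (simp add: bij_betw_def endo_inj_surj)
    from prod.reindex_bij_betw[OF this, of "\<lambda>A. L u0 - L (A *v u)"] show ?thesis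
      by (simp add: F_def matrix_vector_mul_assoc)
  qed
  moreover have "complex_polynomial_function F"
    unfolding F_def by (intro complex_polynomial_function_prod L_poly)
  ultimately obtain p where p: "complex_polynomial_function p" "F = (\<lambda>u. p (x u))"
    using x unfolding basic_invariants_def invariant_polynomial_def by blast
  have "\<And>\<alpha>. complex_polynomial_function (\<lambda>u. x u $ \<alpha>)"
    using x unfolding basic_invariants_def invariant_polynomial_def by blast
  note dx = complex_polynomial_map_has_derivative(1)[OF this, of u0]
  have dF: "(F has_derivative (\<lambda>w. frechet_derivative p (at (x u0)) (frechet_derivative x (at u0) w)))
      (at u0)"
    unfolding p(2) using diff_chain_at[OF dx complex_polynomial_function_has_derivative[OF p(1)]]
    by (simp add: o_def)
  have L': "((\<lambda>u. L u0 - L u) has_derivative (\<lambda>w. - L w)) (at u0)"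
    unfolding L_def
    by (auto intro!: derivative_eq_intros bounded_linear_imp_has_derivative sum.cong
        simp flip: sum_negf)
  have "complex_polynomial_function R"
    unfolding R_def by (intro complex_polynomial_function_prod L_poly)
  note R' = complex_polynomial_function_has_derivative[OF this, of u0]
  \<comment> \<open>The factor \<open>L u0 - L u\<close> vanishes at \<open>u0\<close>, so the
    derivative of \<open>R\<close> drops out of the product rule.\<close>
  have "(F has_derivative (\<lambda>w. - L w * R u0)) (at u0)"
    using has_derivative_mult[OF L' R'] by (simp add: F[abs_def])
  from has_derivative_unique[OF this dF]
  have "- L v * R u0 = frechet_derivative p (at (x u0)) (frechet_derivative x (at u0) v)"
    by meson
  also have "\<dots> = 0"
    using v has_derivative_linear[OF complex_polynomial_function_has_derivative[OF p(1)], of "x u0"]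
    by (simp add: linear_0)
  finally have "L v = 0 \<or> R u0 = 0" by simp
  moreover have "L v \<noteq> 0" using l by (auto simp: L_def W_def)
  moreover have "R u0 \<noteq> 0"
    using l G(1) by (auto simp: R_def W_def simp flip: L_def L_diff)
  ultimately show False by simp
qed

text \<open>The fixed spaces of nonidentity elements are finitely many proper subspaces, so some
  point has trivial stabilizer. The differential of the orbit map is injective there, and the
  inverse function theorem gives a chart.\<close>

lemma orbit_map_chart:
  fixes x :: "'n::{finite,linorder} cvec \<Rightarrow> 'n cvec"
  assumes G: "finite G" "subgroup G general_linear_group"
    and x: "basic_invariants G x d"
  obtains U g g' where "open U" "U \<noteq> {}" "U \<subseteq> regular_vectors G" "inj_on x U" "open (x ` U)"
    "\<And>p. p \<in> x ` U \<Longrightarrow> (g has_derivative g' p) (at p)" "\<And>u. u \<in> U \<Longrightarrow> g (x u) = u"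
    "\<And>u. u \<in> U \<Longrightarrow> bij (frechet_derivative x (at u))"
proof -
  define f where "f u = frechet_derivative x (at u)" for u
  have px: "\<And>\<alpha>. complex_polynomial_function (\<lambda>u. x u $ \<alpha>)"
    using x unfolding basic_invariants_def invariant_polynomial_def by blast
  note dx = complex_polynomial_map_has_derivative[OF px]
  \<comment> \<open>Trivial stabilizer is the condition under which the differential was shown to be
    injective. It is open and implies regularity.\<close>
  define O1 where "O1 = {u. \<forall>A\<in>G. A \<noteq> mat 1 \<longrightarrow> A *v u \<noteq> u}"
  have "O1 = (\<Inter>A\<in>G - {mat 1}. {u. A *v u \<noteq> u})"
    by (auto simp: O1_def)
  moreover have "open {u. A *v u \<noteq> u}" for A :: "'n cmat"
    by (intro open_Collect_neq continuous_intros linear_continuous_on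
        linear_linear[THEN iffD1] matrix_vector_mul_linear)
  ultimately have "open O1" using G(1) by auto
  have "O1 \<subseteq> regular_vectors G"
    by (auto simp: O1_def regular_vectors_def is_reflection_def fixed_space_def)
  have "\<exists>v. \<forall>S\<in>fixed_space ` (G - {mat 1}). v \<notin> S"
  proof (rule subspaces_union_not_UNIV)
    fix S assume "S \<in> fixed_space ` (G - {mat 1})"
    then obtain A where A: "A \<noteq> mat 1" "S = fixed_space A" by auto
    have "vec.subspace S"
      by (auto simp: A vec.subspace_def fixed_space_def matrix_vector_right_distrib
          vec.scale matrix_vector_mult_scaleR vector_scalar_commute)
    moreover have "S \<noteq> UNIV"
      using A by (auto simp: fixed_space_def matrix_eq)
    ultimately show "vec.subspace S \<and> S \<noteq> UNIV" by simp
  qed (use G in auto)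
  then obtain u0 where u0: "u0 \<in> O1" by (auto simp: O1_def fixed_space_def)
  have bl: "bounded_linear (f u)" for u
    using dx(1) unfolding f_def by (rule has_derivative_bounded_linear)
  have "inj (f u0)"
    using orbit_map_derivative_injective[OF G x, of u0] u0 bl[of u0]
    by (auto simp: O1_def linear_injective_0 bounded_linear.linear f_def)
  then obtain k where k: "linear k" "k \<circ> f u0 = id"
    using linear_injective_left_inverse bl bounded_linear.linear by blast
  have "continuous_on O1 (\<lambda>u. f u v)" for v
  proof -
    have "continuous_on O1 (\<lambda>u. f u v $ \<alpha>)" for \<alpha>
      unfolding f_def dx(2)
      using complex_polynomial_function_has_derivative[OF complex_polynomial_function_frechet[OF px]]
      by (meson has_derivative_continuous continuous_at_imp_continuous_on)
    then show ?thesis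
      using continuous_on_vec_lambda[of O1 "\<lambda>\<alpha> u. f u v $ \<alpha>"] by simp
  qed
  \<comment> \<open>The inverse function theorem wants the differential to vary continuously as a
    bounded operator; in finite dimension this can be tested on each vector.\<close>
  then have cont: "continuous_on O1 (\<lambda>u. Blinfun (f u))"
    by (intro continuous_on_blinfun_componentwise) (simp add: bounded_linear_Blinfun_apply[OF bl])
  have "Blinfun k o\<^sub>L Blinfun (f u0) = id_blinfun"
    using k by (intro blinfun_eqI)
      (auto simp: bounded_linear_Blinfun_apply[OF bl] bounded_linear_Blinfun_apply
        linear_conv_bounded_linear o_def id_def fun_eq_iff)
  moreover have "\<And>u. u \<in> O1 \<Longrightarrow> (x has_derivative blinfun_apply (Blinfun (f u))) (at u)"
    using dx(1) by (simp add: bounded_linear_Blinfun_apply[OF bl]) (simp add: f_def)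
  ultimately obtain U V g g' where UV: "open U" "U \<subseteq> O1" "u0 \<in> U" "open V" "homeomorphism U V x g"
    and g: "\<And>p. p \<in> V \<Longrightarrow> (g has_derivative g' p) (at p)"
    and bij: "\<And>p. p \<in> V \<Longrightarrow> bij (Blinfun (f (g p)))"
    using inverse_function_theorem[OF \<open>open O1\<close> _ cont u0, of x] by (metis (no_types, lifting))
  have xU: "x ` U = V" and gx: "\<And>u. u \<in> U \<Longrightarrow> g (x u) = u"
    using UV(5) by (auto simp: homeomorphism_def)
  show ?thesis
  proof (rule that[of U g g'])
    show "U \<subseteq> regular_vectors G" using UV(2) \<open>O1 \<subseteq> regular_vectors G\<close> by blast
    show "inj_on x U" using gx by (metis inj_onI)
    show "bij (frechet_derivative x (at u))" if "u \<in> U" for u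
      using bij[of "x u"] gx[OF that] that xU
      by (auto simp: bounded_linear_Blinfun_apply[OF bl]) (simp add: f_def)
  qed (use UV xU g gx in auto)
qed

section \<open>Tensor calculus in constant frames\<close>

lemma holomorphic_fun_onD:
  assumes "holomorphic_fun_on S f" "p \<in> S"
  shows "(f has_derivative frechet_derivative f (at p)) (at p)"
    and "frechet_derivative f (at p) (c *s v) = c * frechet_derivative f (at p) v"
proof -
  obtain D where D: "(f has_derivative D) (at p)" "\<And>c v. D (c *s v) = c * D v"
    using assms unfolding holomorphic_fun_on_def by blast
  then show "(f has_derivative frechet_derivative f (at p)) (at p)"
    "frechet_derivative f (at p) (c *s v) = c * frechet_derivative f (at p) v"
    using frechet_derivative_at[OF D(1)] by simp_all
qed

lemma holomorphic_fun_on_const [simp]: "holomorphic_fun_on S (\<lambda>_. c)"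
  by (auto simp: holomorphic_fun_on_def intro!: exI[of _ "\<lambda>_. 0"])

lemma vector_field_on_const [simp]: "vector_field_on S (\<lambda>_. c)"
  by (simp add: vector_field_on_def)

lemma holomorphic_fun_on_cmult:
  assumes "holomorphic_fun_on S f"
  shows "holomorphic_fun_on S (\<lambda>p. c * f p)"
  unfolding holomorphic_fun_on_def
proof
  fix p assume "p \<in> S"
  note D = holomorphic_fun_onD[OF assms this]
  show "\<exists>D. ((\<lambda>p. c * f p) has_derivative D) (at p) \<and> (\<forall>b v. D (b *s v) = b * D v)"
    using has_derivative_mult_right[OF D(1), of c] D(2)
    by (intro exI[of _ "\<lambda>v. c * frechet_derivative f (at p) v"]) auto
qed

text \<open>Restriction to the complex line through a point of \<open>W\<close> and \<open>q\<close>
  reduces the claim to the identity theorem in one variable.\<close>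

lemma holomorphic_fun_on_identity:
  assumes f: "holomorphic_fun_on UNIV f" and g: "holomorphic_fun_on UNIV g"
    and W: "open W" "W \<noteq> {}" "\<And>p. p \<in> W \<Longrightarrow> f p = g p"
  shows "f q = g q"
proof -
  obtain p where p: "p \<in> W" using W(2) by auto
  define c where "c t = p + t *s (q - p)" for t
  have c: "(c has_derivative (\<lambda>t. t *s (q - p))) (at t)" for t
    unfolding c_def
  proof (rule has_derivative_vecI)
    have "((\<lambda>t. p $ i + t * (q - p) $ i) has_derivative (\<lambda>t. t * (q - p) $ i)) (at t)" for i
      by (auto intro!: derivative_eq_intros)
    then show "((\<lambda>t. (p + t *s (q - p)) $ i) has_derivative (\<lambda>t. (t *s (q - p)) $ i)) (at t)" for i
      by (simp only: vector_add_component vector_smult_component)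
  qed
  \<comment> \<open>Complex linearity of the differential of \<open>h\<close> turns its derivative
    along the line into multiplication by a complex number.\<close>
  have hol: "(h \<circ> c) holomorphic_on UNIV" if h: "holomorphic_fun_on UNIV h" for h
  proof (rule holomorphic_onI)
    fix t
    have "((h \<circ> c) has_derivative
        frechet_derivative h (at (c t)) \<circ> (\<lambda>s. s *s (q - p))) (at t)"
      by (rule diff_chain_at[OF c holomorphic_fun_onD(1)[OF h UNIV_I]])
    moreover have "frechet_derivative h (at (c t)) \<circ> (\<lambda>s. s *s (q - p))
        = (*) (frechet_derivative h (at (c t)) (q - p))"
      by (rule ext) (simp only: o_def holomorphic_fun_onD(2)[OF h UNIV_I] mult.commute)
    ultimately have "((h \<circ> c) has_field_derivative frechet_derivative h (at (c t)) (q - p)) (at t)"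
      by (simp only: has_field_derivative_def)
    then show "(h \<circ> c) field_differentiable at t within UNIV"
      by (auto simp: field_differentiable_def)
  qed
  have "continuous_on UNIV c"
    by (intro continuous_at_imp_continuous_on ballI has_derivative_continuous[OF c])
  then have "open (c -` W)" by (rule open_vimage[OF W(1)])
  moreover have "c -` W \<noteq> {}"
  proof -
    have "0 \<in> c -` W" using p by (simp add: c_def)
    then show ?thesis by blast
  qed
  ultimately have "(f \<circ> c) 1 = (g \<circ> c) 1"
    by (rule analytic_continuation_open[OF _ open_UNIV _ connected_UNIV subset_UNIV hol[OF f] hol[OF g]])
      (simp_all add: W(3))
  then show ?thesis by (simp add: c_def)
qed

lemma vector_field_onD:
  assumes "vector_field_on S X" "p \<in> S"
  shows "(X has_derivative frechet_derivative X (at p)) (at p)"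
proof -
  have "(X has_derivative (\<lambda>v. \<chi> i. frechet_derivative (\<lambda>p. X p $ i) (at p) v)) (at p)"
    using assms by (intro has_derivative_vecI)
      (auto simp: vector_field_on_def intro: holomorphic_fun_onD(1))
  then show ?thesis by (metis frechet_derivative_at)
qed

lemma cov_deriv_const_right: "cov_deriv \<Gamma> X (\<lambda>_. w) p = \<Gamma> p (X p) w"
  by (simp add: cov_deriv_def)

lemma lie_bracket_const: "lie_bracket (\<lambda>_. v) (\<lambda>_. w) p = 0"
  by (simp add: lie_bracket_def)

lemma tensor21_onD:
  assumes "tensor21_on S T" "p \<in> S"
  shows "Vector_Spaces.linear (*s) (*s) (T p v)" "Vector_Spaces.linear (*s) (*s) (\<lambda>w. T p w v)"
    "vector_field_on S (\<lambda>p. T p v w)"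
  using assms by (auto simp: tensor21_on_def eta_contract_eq)

lemma tensor21_on_zero:
  assumes "tensor21_on S T" "p \<in> S"
  shows "T p v 0 = 0" "T p 0 v = 0"
  using tensor21_onD[OF assms, of v] by (auto dest: vec.linear_0)

text \<open>For constant fields the bracket and all derivatives vanish, so only the Christoffel
  symbols remain in the torsion.\<close>

lemma torsion_free_on_sym:
  assumes "torsion_free_on S \<Gamma>" "open S" "p \<in> S"
  shows "\<Gamma> p v w = \<Gamma> p w v"
  using assms(1)[unfolded torsion_free_on_def, rule_format, of S "\<lambda>_. v" "\<lambda>_. w" p] assms(2,3)
  by (simp add: cov_deriv_const_right lie_bracket_const)

lemma metric_onD:
  assumes "metric_on S g" "p \<in> S"
  shows "Vector_Spaces.linear (*s) (*) (g p v)" "g p v w = g p w v"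
    "Vector_Spaces.linear (*s) (*) (\<lambda>u. g p u w)"
proof -
  show l: "Vector_Spaces.linear (*s) (*) (g p v)" and s: "g p v w = g p w v" for v w
    using assms unfolding metric_on_def by (auto simp: eta_contract_eq)
  have "(\<lambda>u. g p u w) = g p w" using s by blast
  then show "Vector_Spaces.linear (*s) (*) (\<lambda>u. g p u w)" using l by simp
qed

lemma metric_on_nondegenerate:
  assumes "metric_on S g" "p \<in> S" "\<And>w. g p v w = 0"
  shows "v = 0"
  using assms by (auto simp: metric_on_def)

lemma metric_on_holomorphic: "metric_on S g \<Longrightarrow> holomorphic_fun_on S (\<lambda>p. g p v w)"
  by (simp add: metric_on_def)

lemma linear_scalarD:
  assumes "Vector_Spaces.linear (*s) (*) (f :: 'a::field^'n \<Rightarrow> 'a)"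
  shows "f (v + w) = f v + f w" "f (c *s v) = c * f v" "f 0 = 0" "f (v - w) = f v - f w"
    "f (- v) = - f v"
proof -
  interpret Vector_Spaces.linear "(*s)" "(*)" f by fact
  show "f (v + w) = f v + f w" "f (c *s v) = c * f v" "f 0 = 0" "f (v - w) = f v - f w"
    "f (- v) = - f v"
    by (simp_all add: add scale zero diff neg)
qed

lemma metric_on_simps:
  assumes "metric_on S g" "p \<in> S"
  shows "g p (v + w) u = g p v u + g p w u" "g p u (v + w) = g p u v + g p u w"
    "g p (v - w) u = g p v u - g p w u" "g p u (v - w) = g p u v - g p u w"
    "g p (c *s v) u = c * g p v u" "g p u (c *s v) = c * g p u v"
    "g p 0 u = 0" "g p u 0 = 0" "g p (- v) u = - g p v u" "g p u (- v) = - g p u v"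
  using linear_scalarD[OF metric_onD(1)[OF assms]] linear_scalarD[OF metric_onD(3)[OF assms]]
  by simp_all

lemma linear_sum_axis:
  fixes f :: "'a::field^'n \<Rightarrow> 'a"
  assumes "Vector_Spaces.linear (*s) (*) f"
  shows "f v = (\<Sum>i\<in>UNIV. v $ i * f (axis i 1))"
proof -
  interpret Vector_Spaces.linear "(*s)" "(*)" f by fact
  have "f v = f (\<Sum>i\<in>UNIV. v $ i *s axis i 1)" by (simp add: basis_expansion)
  also have "\<dots> = (\<Sum>i\<in>UNIV. v $ i * f (axis i 1))" by (simp add: sum scale)
  finally show ?thesis .
qed

lemma euler_field_linear:
  "bounded_linear (euler_field d :: 'n::{finite,linorder} cvec \<Rightarrow> 'n cvec)"
proof -
  have "linear (euler_field d :: 'n cvec \<Rightarrow> 'n cvec)"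
    by (intro linearI) (auto simp: euler_field_def vec_eq_iff algebra_simps add_divide_distrib scaleR_conv_of_real)
  then show ?thesis by (simp add: linear_conv_bounded_linear)
qed

lemma euler_field_axis:
  "euler_field d (axis \<alpha> 1) = (of_nat (d \<alpha>) / of_nat (d first_index)) *s axis \<alpha> 1"
  by (auto simp: euler_field_def vec_eq_iff axis_def)

lemma lie_bracket_euler_const:
  "lie_bracket (euler_field d) (\<lambda>_. v) p = - euler_field d v"
proof -
  have "(euler_field d has_derivative euler_field d) (at p)"
    by (intro bounded_linear_imp_has_derivative euler_field_linear)
  then have "frechet_derivative (euler_field d) (at p) = euler_field d"
    using frechet_derivative_at by metis
  then show ?thesis by (simp add: lie_bracket_def)
qed

section \<open>Saito structures along the unit field\<close>

lemma unit_field_const: "unit_field = (\<lambda>_. axis first_index 1)"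
  by (simp add: unit_field_def fun_eq_iff)

lemma saito_structure_onD:
  assumes "saito_structure_on UNIV \<Gamma> m e E"
  shows "tensor21_on UNIV \<Gamma>" "\<Gamma> p v w = \<Gamma> p w v" "tensor21_on UNIV m"
    "m p (m p v w) z = m p v (m p w z)" "m p v w = m p w v" "m p (e p) v = v"
  using assms torsion_free_on_sym[of UNIV \<Gamma>]
  by (auto simp: saito_structure_on_def)

lemma saito_unit_flat:
  assumes "saito_structure_on UNIV \<Gamma> m unit_field E"
  shows "\<Gamma> p v (axis first_index 1) = 0" "\<Gamma> p (axis first_index 1) v = 0"
proof -
  have "cov_deriv \<Gamma> (\<lambda>_. v) unit_field p = 0"
    using assms[unfolded saito_structure_on_def]
    by (elim conjE) (drule spec[of _ UNIV], drule spec[of _ "\<lambda>_. v"], simp)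
  then show "\<Gamma> p v (axis first_index 1) = 0"
    by (simp add: unit_field_const cov_deriv_const_right)
  then show "\<Gamma> p (axis first_index 1) v = 0"
    using saito_structure_onD(2)[OF assms] by metis
qed

text \<open>Put \<open>X = e\<close> and constant \<open>v\<close>, \<open>w\<close> into the
  compatibility of connection and multiplication. As \<open>e\<close> is flat and is the unit, the
  two terms \<open>\<Gamma> q v w\<close> cancel and only the derivative of the product along
  \<open>e\<close> is left.\<close>

lemma saito_mul_unit_translate:
  assumes S: "saito_structure_on UNIV \<Gamma> m unit_field E"
  shows "m (p + r *\<^sub>R axis first_index 1) v w = m p v w"
proof -
  define e :: "'a cvec" where "e = axis first_index 1"
  define M where "M q = m q v w" for q
  have unit: "m q e z = z" for q z
    using saito_structure_onD(6)[OF S, of q z] by (simp add: e_def unit_field_const)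
  have "frechet_derivative M (at q) e = 0" for q
  proof -
    have "cov_deriv \<Gamma> (\<lambda>_. e) (times_field m (\<lambda>_. v) (\<lambda>_. w)) q
        - times_field m (\<lambda>_. v) (cov_deriv \<Gamma> (\<lambda>_. e) (\<lambda>_. w)) q
        - cov_deriv \<Gamma> (\<lambda>_. v) (times_field m (\<lambda>_. e) (\<lambda>_. w)) q
        + times_field m (\<lambda>_. e) (cov_deriv \<Gamma> (\<lambda>_. v) (\<lambda>_. w)) q
        = times_field m (lie_bracket (\<lambda>_. e) (\<lambda>_. v)) (\<lambda>_. w) q"
      using S[unfolded saito_structure_on_def]
      by (elim conjE) (drule spec[of _ UNIV], drule spec[of _ "\<lambda>_. e"],
        drule spec[of _ "\<lambda>_. v"], drule spec[of _ "\<lambda>_. w"], simp)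
    moreover have "times_field m (\<lambda>_. v) (\<lambda>_. w) = M"
      by (simp add: times_field_def M_def fun_eq_iff)
    moreover have "times_field m (\<lambda>_. e) (\<lambda>_. w) = (\<lambda>_. w)"
      by (simp add: times_field_def unit fun_eq_iff)
    ultimately show ?thesis
      using saito_unit_flat[OF S, of q] tensor21_on_zero[OF saito_structure_onD(3)[OF S], of q]
      by (simp add: cov_deriv_const_right lie_bracket_const times_field_def unit
          cov_deriv_def[of \<Gamma> _ M] flip: e_def)
  qed
  moreover have "(M has_derivative frechet_derivative M (at q)) (at q)" for q
    using vector_field_onD[OF tensor21_onD(3)[OF saito_structure_onD(3)[OF S] UNIV_I]]
    by (simp add: M_def[abs_def])
  ultimately have "((\<lambda>s. M (p + s *\<^sub>R e)) has_derivative (\<lambda>_. 0)) (at s)" for s :: real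
  proof -
    have "((\<lambda>s. p + s *\<^sub>R e) has_derivative (\<lambda>s. s *\<^sub>R e)) (at s)"
      by (auto intro!: derivative_eq_intros)
    from diff_chain_at[OF this \<open>\<And>q. (M has_derivative frechet_derivative M (at q)) (at q)\<close>]
    have *: "((\<lambda>s. M (p + s *\<^sub>R e)) has_derivative
        (\<lambda>s'. frechet_derivative M (at (p + s *\<^sub>R e)) (s' *\<^sub>R e))) (at s)"
      by (simp add: o_def)
    have "frechet_derivative M (at q) (s' *\<^sub>R e) = 0" for q s'
      using \<open>\<And>q. frechet_derivative M (at q) e = 0\<close>
        linear_scale[OF has_derivative_linear[OF \<open>\<And>q. (M has_derivative frechet_derivative M (at q)) (at q)\<close>]]
      by simp
    with * show ?thesis by simp
  qed
  from has_derivative_zero_unique[OF convex_UNIV this, of r 0]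
  show ?thesis by (simp add: M_def e_def)
qed

text \<open>The first coordinate has weight one in the Euler field, so the translation adds
  \<open>r\<close> times the unit to \<open>E\<close>, while the multiplication itself does not
  change.\<close>

lemma saito_mul_euler_translate:
  assumes S: "saito_structure_on UNIV \<Gamma> m unit_field (euler_field d)" and d: "d first_index \<noteq> 0"
  shows "m (p + r *\<^sub>R axis first_index 1) (euler_field d (p + r *\<^sub>R axis first_index 1)) v
    = m p (euler_field d p) v + r *\<^sub>R v"
proof -
  have E: "euler_field d (p + r *\<^sub>R axis first_index 1)
      = euler_field d p + of_real r *s axis first_index 1"
    using d by (auto simp: euler_field_def vec_eq_iff axis_def scaleR_conv_of_real[where 'a=complex] algebra_simps)
  interpret Vector_Spaces.linear "(*s)" "(*s)" "\<lambda>w. m p w v"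
    by (rule tensor21_onD(2)[OF saito_structure_onD(3)[OF S] UNIV_I])
  show ?thesis
    using saito_structure_onD(6)[OF S, of p v]
    by (simp add: saito_mul_unit_translate[OF S] E add scale unit_field_const)
      (simp add: vec_eq_iff scaleR_conv_of_real[where 'a=complex])
qed

section \<open>Frobenius metrics with quasihomogeneous Euler field\<close>

lemma metric_connection_const:
  assumes "metric_connection_on UNIV g \<Gamma>"
  shows "frechet_derivative (\<lambda>p. g p v w) (at p) u = g p (\<Gamma> p u v) w + g p v (\<Gamma> p u w)"
  using assms[unfolded metric_connection_on_def, rule_format,
      of UNIV "\<lambda>_. u" "\<lambda>_. v" "\<lambda>_. w" p]
  by (simp add: field_apply_def eval_metric_def[abs_def] cov_deriv_const_right)

lemma frobenius_structure_onD:
  assumes "frobenius_structure_on UNIV \<Gamma> m e E D g"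
  shows "saito_structure_on UNIV \<Gamma> m e E" "metric_on UNIV g" "metric_connection_on UNIV g \<Gamma>"
    "g p (m p u v) w = g p u (m p v w)"
proof -
  show "saito_structure_on UNIV \<Gamma> m e E" "metric_on UNIV g" "metric_connection_on UNIV g \<Gamma>"
    using assms by (simp_all add: frobenius_structure_on_def)
  have "eval_metric g (times_field m (\<lambda>_. u) (\<lambda>_. v)) (\<lambda>_. w) p
      = eval_metric g (\<lambda>_. u) (times_field m (\<lambda>_. v) (\<lambda>_. w)) p"
    using assms[unfolded frobenius_structure_on_def]
    by (elim conjE) (drule spec[of _ UNIV], drule spec[of _ "\<lambda>_. u"],
      drule spec[of _ "\<lambda>_. v"], drule spec[of _ "\<lambda>_. w"], simp)
  then show "g p (m p u v) w = g p u (m p v w)"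
    by (simp add: eval_metric_def times_field_def)
qed

lemma frobenius_homogeneous:
  assumes "frobenius_structure_on UNIV \<Gamma> m e (euler_field d) D g"
  shows "frechet_derivative (\<lambda>p. g p v w) (at p) (euler_field d p)
    = (2 - D) * g p v w - g p (euler_field d v) w - g p v (euler_field d w)"
proof -
  have "field_apply (euler_field d) (eval_metric g (\<lambda>_. v) (\<lambda>_. w)) p
      - eval_metric g (lie_bracket (euler_field d) (\<lambda>_. v)) (\<lambda>_. w) p
      - eval_metric g (\<lambda>_. v) (lie_bracket (euler_field d) (\<lambda>_. w)) p
      = (2 - D) * eval_metric g (\<lambda>_. v) (\<lambda>_. w) p"
    using assms[unfolded frobenius_structure_on_def]
    by (elim conjE) (drule spec[of _ UNIV], drule spec[of _ "\<lambda>_. v"],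
      drule spec[of _ "\<lambda>_. w"], drule spec[of _ "\<lambda>_. w"], simp)
  then show ?thesis
    using metric_on_simps[OF frobenius_structure_onD(2)[OF assms] UNIV_I, of p]
    by (simp add: field_apply_def eval_metric_def[abs_def] lie_bracket_euler_const algebra_simps)
qed

text \<open>Along the orbit \<open>p\<^sub>t = (t ^ d \<alpha> * p $ \<alpha>)\<^sub>\<alpha>\<close>, the function \<open>t ^ k * f p\<^sub>t\<close>
  is constant.\<close>

lemma weighted_homogeneous_nonpositive:
  fixes f :: "'n::{finite,linorder} cvec \<Rightarrow> complex"
  assumes f: "holomorphic_fun_on UNIV f" and d: "\<And>\<alpha>. d \<alpha> > 0"
    and hom: "\<And>p. of_nat (d first_index) * frechet_derivative f (at p) (euler_field d p) = - of_nat k * f p"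
  shows "f p = (if k = 0 then f 0 else 0)"
proof -
  define c where "c t = (\<chi> \<alpha>. of_real t ^ d \<alpha> * p $ \<alpha>)" for t
  define \<psi> where "\<psi> t = of_real t ^ k * f (c t)" for t :: real
  have d1: "d first_index \<noteq> 0" using d by (metis less_irrefl)
  have c': "(c has_derivative (\<lambda>s. \<chi> \<alpha>. of_real s * of_nat (d \<alpha>) * of_real t ^ (d \<alpha> - 1) * p $ \<alpha>)) (at t)"
    for t
    unfolding c_def
    by (rule has_derivative_vecI) (auto intro!: derivative_eq_intros simp: mult_ac)
  note f' = holomorphic_fun_onD[OF f UNIV_I]
  have \<psi>: "(\<psi> has_derivative (\<lambda>s. of_real t ^ k * frechet_derivative f (at (c t))
        (\<chi> \<alpha>. of_real s * of_nat (d \<alpha>) * of_real t ^ (d \<alpha> - 1) * p $ \<alpha>)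
      + of_nat k * of_real s * of_real t ^ (k - 1) * f (c t))) (at t)" for t
    unfolding \<psi>_def
    using diff_chain_at[OF c' f'(1), of t]
    by (auto intro!: derivative_eq_intros simp: o_def mult_ac)
  have \<psi>0: "(\<psi> has_derivative (\<lambda>_. 0)) (at t)" if "t > 0" for t
  proof -
    \<comment> \<open>Multiplying by \<open>t\<close> raises each exponent
      \<open>d \<alpha> - 1\<close> to \<open>d \<alpha>\<close>, which turns the velocity of the
      orbit into a multiple of the Euler field, so that \<open>hom\<close> applies.\<close>
    have "of_real t * (of_real t ^ k * frechet_derivative f (at (c t))
        (\<chi> \<alpha>. of_real s * of_nat (d \<alpha>) * of_real t ^ (d \<alpha> - 1) * p $ \<alpha>)
      + of_nat k * of_real s * of_real t ^ (k - 1) * f (c t)) = 0" for s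
    proof -
      have *: "of_real t * (of_real t :: complex) ^ (d \<alpha> - 1) = of_real t ^ d \<alpha>" for \<alpha>
        using d[of \<alpha>] by (metis Suc_diff_1 power_Suc)
      have "of_real t *s (\<chi> \<alpha>. of_real s * of_nat (d \<alpha>) * of_real t ^ (d \<alpha> - 1) * p $ \<alpha>)
          = (of_real s * of_nat (d first_index)) *s euler_field d (c t)"
        using d1 *[symmetric] by (auto simp: vec_eq_iff euler_field_def c_def)
      from arg_cong[OF this, of "frechet_derivative f (at (c t))"]
      have "of_real t * frechet_derivative f (at (c t))
          (\<chi> \<alpha>. of_real s * of_nat (d \<alpha>) * of_real t ^ (d \<alpha> - 1) * p $ \<alpha>)
        = of_real s * (of_nat (d first_index) * frechet_derivative f (at (c t)) (euler_field d (c t)))"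
        by (simp only: f'(2) mult.assoc)
      also have "\<dots> = - of_real s * of_nat k * f (c t)"
        by (simp add: hom)
      finally have 1: "of_real t * frechet_derivative f (at (c t))
          (\<chi> \<alpha>. of_real s * of_nat (d \<alpha>) * of_real t ^ (d \<alpha> - 1) * p $ \<alpha>)
          = - of_real s * of_nat k * f (c t)" .
      have 2: "of_real t * (of_nat k * of_real t ^ (k - 1)) = of_nat k * (of_real t :: complex) ^ k"
        by (cases k) auto
      have "of_real t * (of_real t ^ k * A + of_nat k * of_real s * of_real t ^ (k - 1) * B)
          = of_real t ^ k * (of_real t * A)
            + of_real s * B * (of_real t * (of_nat k * of_real t ^ (k - 1)))" for A B :: complex
        by (simp add: algebra_simps)
      then show ?thesis by (simp only: 1 2) (simp add: algebra_simps)
    qed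
    then show ?thesis using \<psi>[of t] that by simp
  qed
  have "\<psi> 1 = \<psi> 0"
  \<comment> \<open>The derivative was computed for \<open>t > 0\<close> only; at the exceptional
    point 0 continuity suffices. There \<open>0 ^ k\<close> separates \<open>k = 0\<close> from
    \<open>k > 0\<close>.\<close>
  proof (rule has_derivative_zero_unique_strong_interval[of "{0}" 0 1])
    show "continuous_on {0..1} \<psi>"
      by (intro continuous_at_imp_continuous_on ballI has_derivative_continuous[OF \<psi>])
  qed (auto intro!: has_derivative_at_withinI \<psi>0)
  moreover have "c 1 = p" by (simp add: c_def vec_eq_iff)
  moreover have "c 0 = 0" using d by (auto simp: c_def vec_eq_iff zero_power)
  ultimately show ?thesis by (simp add: \<psi>_def power_0_left)
qed

text \<open>The Euler field vanishes at the origin, so basis vectors pairing nontrivially there have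
  degrees with the fixed sum \<open>d first_index * (2 - D)\<close>. Comparing the partners of the
  first and last vectors, whose degrees are extremal, determines \<open>D\<close>. The coefficient
  of \<open>g\<close> at the first and the \<beta>-th vector then has weighted degree
  \<open>d last_index - d \<beta>\<close>, which is never positive; such a function is constant in
  degree zero and vanishes otherwise.\<close>

lemma frobenius_charge_and_covector:
  fixes g :: "'n::{finite,linorder} tensor20"
  assumes F: "frobenius_structure_on UNIV \<Gamma> m unit_field (euler_field d) D g"
    and d: "antimono d" "\<And>\<alpha>. d \<alpha> > 0"
      "\<forall>\<alpha>. \<alpha> \<noteq> first_index \<longrightarrow> d \<alpha> < d first_index"
  shows "D = 1 - of_nat (d last_index) / of_nat (d first_index)"
    and "\<exists>c. c \<noteq> 0 \<and> (\<forall>p v. g p (axis first_index 1) v = c * v $ last_index)"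
proof -
  note g = frobenius_structure_onD(2)[OF F]
  note gs = metric_on_simps[OF g UNIV_I]
  have d1: "d first_index \<noteq> 0" using d(2) by (metis less_irrefl)
  have hom: "of_nat (d first_index) *
      frechet_derivative (\<lambda>p. g p (axis \<alpha> 1) (axis \<beta> 1)) (at p) (euler_field d p)
      = (of_nat (d first_index) * (2 - D) - of_nat (d \<alpha>) - of_nat (d \<beta>)) * g p (axis \<alpha> 1) (axis \<beta> 1)"
    for \<alpha> \<beta> p
    using d1 by (simp add: frobenius_homogeneous[OF F] euler_field_axis gs field_simps)
  have pairing: "of_nat (d first_index) * (2 - D) = of_nat (d \<alpha>) + of_nat (d \<beta>)"
    if "g 0 (axis \<alpha> 1) (axis \<beta> 1) \<noteq> 0" for \<alpha> \<beta>
  proof -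
    have "euler_field d 0 = (0 :: 'n cvec)"
      by (simp add: euler_field_def vec_eq_iff)
    moreover have "linear (frechet_derivative (\<lambda>p. g p (axis \<alpha> 1) (axis \<beta> 1)) (at 0))"
      by (rule has_derivative_linear[OF holomorphic_fun_onD(1)[OF metric_on_holomorphic[OF g] UNIV_I]])
    ultimately show ?thesis
      using hom[of \<alpha> \<beta> 0] that by (simp add: linear_0 diff_diff_eq)
  qed
  have partner: "\<exists>\<beta>. g 0 v (axis \<beta> 1) \<noteq> 0" if "v \<noteq> 0" for v
  proof (rule ccontr)
    assume "\<nexists>\<beta>. g 0 v (axis \<beta> 1) \<noteq> 0"
    then have "g 0 v w = 0" for w
      using linear_sum_axis[OF metric_onD(1)[OF g UNIV_I], of 0 v w] by simp
    with that show False using metric_on_nondegenerate[OF g UNIV_I, of 0 v] by blast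
  qed
  have min: "d last_index \<le> d \<alpha>" and max: "d \<alpha> \<le> d first_index" for \<alpha>
    using d(1) by (simp_all add: antimonoD)
  have axis: "axis \<gamma> (1 :: complex) \<noteq> 0" for \<gamma> :: 'n
    by (simp add: axis_eq_0_iff)
  obtain \<beta> where \<beta>: "g 0 (axis first_index 1) (axis \<beta> 1) \<noteq> 0"
    using partner[OF axis] by blast
  obtain \<alpha> where \<alpha>: "g 0 (axis last_index 1) (axis \<alpha> 1) \<noteq> 0"
    using partner[OF axis] by blast
  have "complex_of_nat (d first_index + d \<beta>) = of_nat (d last_index + d \<alpha>)"
    using pairing[OF \<alpha>] pairing[OF \<beta>] by simp
  then have "d first_index + d \<beta> = d last_index + d \<alpha>" by (rule of_nat_eq_iff[THEN iffD1])
  then have "d \<beta> = d last_index" using min[of \<beta>] max[of \<alpha>] by linarith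
  then have *: "of_nat (d first_index) * (2 - D) = of_nat (d first_index) + of_nat (d last_index)"
    using pairing[OF \<beta>] by simp
  then show D: "D = 1 - of_nat (d last_index) / of_nat (d first_index)"
    using d1 by (simp add: field_simps)
  \<comment> \<open>A second vector of least degree would, like the last one, pair at the origin
    only with the first, because \<open>d first_index\<close> is strictly largest. The combination
    \<open>v\<close> of the two cancels that pairing and contradicts nondegeneracy.\<close>
  have last: "\<alpha> = last_index" if "d \<alpha> = d last_index" for \<alpha>
  proof (rule ccontr)
    assume "\<alpha> \<noteq> last_index"
    define v where "v = g 0 (axis last_index 1) (axis first_index 1) *s axis \<alpha> 1
      - g 0 (axis \<alpha> 1) (axis first_index 1) *s axis last_index 1"
    have first: "\<gamma> = first_index"
      if "g 0 (axis \<beta> 1) (axis \<gamma> 1) \<noteq> 0" "d \<beta> = d last_index" for \<beta> \<gamma>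
    proof (rule ccontr)
      assume "\<gamma> \<noteq> first_index"
      have "complex_of_nat (d first_index + d last_index) = of_nat (d last_index + d \<gamma>)"
        using pairing[OF that(1)] that(2) * by simp
      then have "d first_index + d last_index = d last_index + d \<gamma>"
        by (rule of_nat_eq_iff[THEN iffD1])
      with d(3)[rule_format, OF \<open>\<gamma> \<noteq> first_index\<close>] show False by simp
    qed
    have "g 0 v (axis \<gamma> 1) = 0" for \<gamma>
    proof (cases "\<gamma> = first_index")
      case False
      then have "g 0 (axis \<alpha> 1) (axis \<gamma> 1) = 0" "g 0 (axis last_index 1) (axis \<gamma> 1) = 0"
        using first that by blast+
      then show ?thesis by (simp add: v_def gs)
    qed (simp add: v_def gs)
    then have "v = 0" using partner by blast
    then have "v $ \<alpha> = 0" by simp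
    then have "g 0 (axis last_index 1) (axis first_index 1) = 0"
      using \<open>\<alpha> \<noteq> last_index\<close> by (simp add: v_def axis_def)
    moreover obtain \<gamma> where \<gamma>: "g 0 (axis last_index 1) (axis \<gamma> 1) \<noteq> 0"
      using partner[OF axis] by blast
    ultimately show False using first[OF \<gamma>] by simp
  qed
  define f where "f \<beta> p = g p (axis first_index 1) (axis \<beta> 1)" for \<beta> p
  have f: "f \<beta> p = (if \<beta> = last_index then f \<beta> 0 else 0)" for \<beta> p
  proof -
    \<comment> \<open>The subtraction on naturals is exact because \<open>d last_index\<close> is
      the least degree.\<close>
    have "f \<beta> p = (if d \<beta> - d last_index = 0 then f \<beta> 0 else 0)"
    proof (rule weighted_homogeneous_nonpositive[of _ d])
      show "holomorphic_fun_on UNIV (f \<beta>)"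
        unfolding f_def[abs_def] by (rule metric_on_holomorphic[OF g])
      show "of_nat (d first_index) * frechet_derivative (f \<beta>) (at p) (euler_field d p)
        = - of_nat (d \<beta> - d last_index) * f \<beta> p" for p
        unfolding f_def[abs_def] hom * using min[of \<beta>] by (simp add: of_nat_diff)
    qed (rule d(2))
    moreover have "d \<beta> - d last_index = 0 \<longleftrightarrow> \<beta> = last_index"
    proof
      assume "d \<beta> - d last_index = 0"
      then have "d \<beta> = d last_index" using min[of \<beta>] by linarith
      then show "\<beta> = last_index" by (rule last)
    qed simp
    ultimately show ?thesis by (simp only: )
  qed
  have gf: "g p (axis first_index 1) v = f last_index 0 * v $ last_index" for p v
  proof -
    have "g p (axis first_index 1) v = (\<Sum>\<beta>\<in>UNIV. v $ \<beta> * f \<beta> p)"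
      unfolding f_def by (rule linear_sum_axis[OF metric_onD(1)[OF g UNIV_I]])
    also have "\<dots> = (\<Sum>\<beta>\<in>UNIV. if \<beta> = last_index then v $ \<beta> * f \<beta> 0 else 0)"
      by (rule sum.cong) (auto simp: f[of _ p])
    finally show ?thesis by simp
  qed
  have "f last_index 0 \<noteq> 0"
    using metric_on_nondegenerate[OF g UNIV_I, of 0 "axis first_index 1"] axis by (auto simp: gf)
  with gf show "\<exists>c. c \<noteq> 0 \<and> (\<forall>p v. g p (axis first_index 1) v = c * v $ last_index)"
    by (intro exI conjI allI)
qed

text \<open>The coefficients of \<open>g(e, _)\<close> are constant and \<open>e\<close> is flat, so
  differentiating them leaves only the last component of \<open>\<Gamma>\<close>. The formula for
  \<open>g\<close> comes from inserting the unit and moving the product to the right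
  argument.\<close>

lemma frobenius_last_christoffel:
  fixes g :: "'n::{finite,linorder} tensor20"
  assumes F: "frobenius_structure_on UNIV \<Gamma> m unit_field E D g"
    and c: "c \<noteq> 0" "\<And>p v. g p (axis first_index 1) v = c * v $ last_index"
  shows "\<Gamma> p v w $ last_index = 0" "g p v w = c * m p v w $ last_index"
proof -
  note S = frobenius_structure_onD(1)[OF F]
  have "0 = frechet_derivative (\<lambda>p. g p (axis first_index 1) w) (at p) v"
    by (simp add: c)
  also have "\<dots> = g p (\<Gamma> p v (axis first_index 1)) w + g p (axis first_index 1) (\<Gamma> p v w)"
    by (rule metric_connection_const[OF frobenius_structure_onD(3)[OF F]])
  also have "\<dots> = c * \<Gamma> p v w $ last_index"
    using metric_on_simps[OF frobenius_structure_onD(2)[OF F] UNIV_I]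
    by (simp add: saito_unit_flat[OF S] c)
  finally show "\<Gamma> p v w $ last_index = 0" using c by simp
  have "g p v w = g p (m p (axis first_index 1) v) w"
    using saito_structure_onD(6)[OF S] by (simp add: unit_field_const)
  then show "g p v w = c * m p v w $ last_index"
    using frobenius_structure_onD(4)[OF F] c by simp
qed

section \<open>The Hessian metric and comparison of the two structures\<close>

lemma linear_vec_nth: "Vector_Spaces.linear (*s) (*) (\<lambda>v :: 'a::field^'n. v $ i)"
  by (intro Vector_Spaces.linear.intro module_hom.intro vec.module_axioms
        vec.vector_space_axioms module_hom_axioms.intro vector_space_over_itself.vector_space_axioms
        vector_space_over_itself.module_axioms) auto

lemma tensor21_component_linear:
  assumes "tensor21_on S T" "p \<in> S"
  shows "Vector_Spaces.linear (*s) (*) (\<lambda>w. T p v w $ i)"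
    "Vector_Spaces.linear (*s) (*) (\<lambda>v. T p v w $ i)"
  using Vector_Spaces.linear_compose[OF tensor21_onD(1)[OF assms] linear_vec_nth]
    Vector_Spaces.linear_compose[OF tensor21_onD(2)[OF assms] linear_vec_nth]
  by (simp_all add: o_def)

lemma linear_compose_sum_axis:
  fixes f :: "'a::field^'n \<Rightarrow> 'a" and L :: "'a^'n \<Rightarrow> 'a^'n"
  assumes "Vector_Spaces.linear (*s) (*s) L" "Vector_Spaces.linear (*s) (*) f"
  shows "f (L v) = (\<Sum>i\<in>UNIV. v $ i * f (L (axis i 1)))"
  using linear_sum_axis[OF Vector_Spaces.linear_compose[OF assms], of v] by (simp only: o_def)

text \<open>With \<open>L\<close> the differential of the orbit map, the vectors
  \<open>L (axis i 1)\<close> are the coordinate frame of the linear coordinates on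
  \<open>V\<close>, in which the Hessian metric and the linear connection are specified.\<close>

lemma bilinear_forms_eqI:
  fixes B B' :: "'a::field^'n \<Rightarrow> 'a^'n \<Rightarrow> 'a" and L :: "'a^'n \<Rightarrow> 'a^'n"
  assumes L: "Vector_Spaces.linear (*s) (*s) L" "bij L"
    and B: "\<And>v. Vector_Spaces.linear (*s) (*) (B v)" "\<And>w. Vector_Spaces.linear (*s) (*) (\<lambda>v. B v w)"
    and B': "\<And>v. Vector_Spaces.linear (*s) (*) (B' v)" "\<And>w. Vector_Spaces.linear (*s) (*) (\<lambda>v. B' v w)"
    and eq: "\<And>i j. B (L (axis i 1)) (L (axis j 1)) = B' (L (axis i 1)) (L (axis j 1))"
  shows "B v w = B' v w"
proof -
  have expand: "A (L a) (L b) = (\<Sum>i\<in>UNIV. a $ i * (\<Sum>j\<in>UNIV. b $ j * A (L (axis i 1)) (L (axis j 1))))"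
    if "\<And>v. Vector_Spaces.linear (*s) (*) (A v)" "\<And>w. Vector_Spaces.linear (*s) (*) (\<lambda>v. A v w)"
    for A a b
  proof -
    have "A (L a) (L b) = (\<Sum>i\<in>UNIV. a $ i * A (L (axis i 1)) (L b))"
      by (rule linear_compose_sum_axis[OF L(1) that(2)])
    moreover have "A (L (axis i 1)) (L b) = (\<Sum>j\<in>UNIV. b $ j * A (L (axis i 1)) (L (axis j 1)))" for i
      by (rule linear_compose_sum_axis[OF L(1) that(1)])
    ultimately show ?thesis by simp
  qed
  obtain a b where "v = L a" "w = L b"
    using L(2) by (metis bij_pointE)
  then show ?thesis
    using expand[of B a b, OF B] expand[of B' a b, OF B'] by (simp add: eq)
qed

section \<open>Euler's identity and the degrees of the basic invariants\<close>

lemma basic_invariants_polynomial: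
  "basic_invariants G x d \<Longrightarrow> complex_polynomial_function (\<lambda>u. x u $ \<alpha>)"
  by (simp add: basic_invariants_def invariant_polynomial_def)

text \<open>Both sides are the derivative of \<open>x (s *\<^sub>R u) $ \<alpha>\<close> at
  \<open>s = 1\<close>.\<close>

lemma basic_invariants_euler_identity:
  fixes x :: "'n::{finite,linorder} cvec \<Rightarrow> 'n cvec"
  assumes x: "basic_invariants G x d"
  shows "frechet_derivative x (at u) u $ \<alpha> = of_nat (d \<alpha>) * x u $ \<alpha>"
proof -
  note dx = complex_polynomial_map_has_derivative(1)[OF basic_invariants_polynomial[OF x]]
  have "((\<lambda>s :: real. s *\<^sub>R u) has_derivative (\<lambda>s. s *\<^sub>R u)) (at 1)"
    by (auto intro!: derivative_eq_intros)
  from diff_chain_at[OF this, of x "frechet_derivative x (at u)"]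
  have "((\<lambda>s. x (s *\<^sub>R u)) has_derivative (\<lambda>s. frechet_derivative x (at u) (s *\<^sub>R u))) (at 1)"
    using dx[of u] by (simp add: o_def)
  then have 1: "((\<lambda>s. x (s *\<^sub>R u) $ \<alpha>) has_derivative (\<lambda>s. frechet_derivative x (at u) (s *\<^sub>R u) $ \<alpha>)) (at 1)"
    by (rule bounded_linear.has_derivative[OF bounded_linear_vec_nth])
  have "s *\<^sub>R u = of_real s *s u" for s
    by (simp add: vec_eq_iff scaleR_conv_of_real[where 'a=complex])
  then have "x (s *\<^sub>R u) $ \<alpha> = of_real s ^ d \<alpha> * x u $ \<alpha>" for s
    using x by (simp add: basic_invariants_def)
  moreover have "((\<lambda>s. of_real s ^ d \<alpha> * x u $ \<alpha>) has_derivative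
      (\<lambda>s. of_real s * of_nat (d \<alpha>) * x u $ \<alpha>)) (at (1 :: real))"
    by (auto intro!: derivative_eq_intros)
  ultimately have "((\<lambda>s. x (s *\<^sub>R u) $ \<alpha>) has_derivative
      (\<lambda>s. of_real s * of_nat (d \<alpha>) * x u $ \<alpha>)) (at (1 :: real))"
    by (simp only:)
  from fun_cong[OF has_derivative_unique[OF 1 this], of 1] show ?thesis by simp
qed

text \<open>An invariant of degree zero is constant, as scaling by 0 with \<open>0 ^ 0 = 1\<close>
  shows, so one component of the differential would vanish identically.\<close>

lemma basic_invariants_degree_pos:
  fixes x :: "'n::{finite,linorder} cvec \<Rightarrow> 'n cvec"
  assumes x: "basic_invariants G x d" and bij: "bij (frechet_derivative x (at u))"
  shows "d \<alpha> > 0"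
proof (rule ccontr)
  assume d: "\<not> d \<alpha> > 0"
  have "x (0 *s w) $ \<alpha> = 0 ^ d \<alpha> * x w $ \<alpha>" for w
    using x unfolding basic_invariants_def by blast
  then have "x 0 $ \<alpha> = x w $ \<alpha>" for w using d by simp
  then have "(\<lambda>w. x w $ \<alpha>) = (\<lambda>_. x 0 $ \<alpha>)" by (intro ext) (rule sym)
  then have "frechet_derivative x (at u) v $ \<alpha> = 0" for v
    by (simp add: complex_polynomial_map_has_derivative(2)[OF basic_invariants_polynomial[OF x]])
  moreover obtain v where "frechet_derivative x (at u) v = axis \<alpha> 1"
    using bij by (metis bij_pointE)
  ultimately show False by (metis axis_nth zero_neq_one)
qed

text \<open>The frame of linear coordinates is parallel, so on it the Christoffel symbol is minus
  the second derivative of \<open>x\<close>, whose last component is the Hessian. The Euler field is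
  the radial field divided by \<open>d first_index\<close>, and the first derivatives of the last
  invariant are homogeneous of degree \<open>d last_index - 1\<close>.\<close>

lemma hessian_metric_christoffel:
  fixes x :: "'n::{finite,linorder} cvec \<Rightarrow> 'n cvec"
  assumes x: "basic_invariants G x d" and h: "hessian_metric G x h"
    and \<Gamma>: "linear_connection_on_orbits G x \<Gamma>"
    and U: "open U" "U \<subseteq> regular_vectors G" "inj_on x U" "open (x ` U)"
    and g: "\<And>p. p \<in> x ` U \<Longrightarrow> (g has_derivative g' p) (at p)" "\<And>u. u \<in> U \<Longrightarrow> g (x u) = u"
    and bij: "\<And>u. u \<in> U \<Longrightarrow> bij (frechet_derivative x (at u))"
    and p: "p \<in> x ` U"
  shows "h p v w = - \<Gamma> p v w $ last_index"
    and "h p v (euler_field d p)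
      = (of_nat (d last_index) - 1) / of_nat (d first_index) * v $ last_index"
proof -
  define dx where "dx u = frechet_derivative x (at u)" for u
  define f where "f u = x u $ last_index" for u
  note px = basic_invariants_polynomial[OF x]
  have pf: "complex_polynomial_function f" unfolding f_def[abs_def] by (rule px)
  have dx_f: "dx u v $ last_index = frechet_derivative f (at u) v" for u v
    unfolding dx_def f_def[abs_def] by (rule complex_polynomial_map_has_derivative(2)[OF px])
  have dx: "(x has_derivative dx u) (at u)" for u
    unfolding dx_def by (rule complex_polynomial_map_has_derivative(1)[OF px])
  have lin: "Vector_Spaces.linear (*s) (*s) (dx u)" for u
    unfolding dx_def by (rule complex_polynomial_map_frechet_linear[OF px])
  obtain u where u: "u \<in> U" "p = x u" using p by auto
  have pS: "p \<in> x ` regular_vectors G" using u U(2) by auto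
  have bij_u: "bij (dx u)" using bij u by (simp add: dx_def)
  have cf: "coord_field x U j q = dx (g q) (axis j 1)" if "q \<in> x ` U" for q j
    using that U(3) g(2) by (auto simp: coord_field_def dx_def)
  have cfp: "coord_field x U j p = dx u (axis j 1)" for j
    using cf[OF p] g(2) u by simp
  have g'_dx: "g' p (dx u v) = v" for v
  proof -
    have "((\<lambda>u. g (x u)) has_derivative (\<lambda>v. g' p (dx u v))) (at u)"
      using diff_chain_at[OF dx g(1), of u] p u by (simp add: o_def)
    then have "((\<lambda>u. u) has_derivative (\<lambda>v. g' p (dx u v))) (at u)"
      by (rule has_derivative_transform_within_open[OF _ U(1) u(1)]) (rule g(2))
    from has_derivative_unique[OF this has_derivative_ident] show ?thesis by meson
  qed
  have hess: "h p (dx u (axis i 1)) (dx u (axis j 1)) = partial_deriv i (partial_deriv j f) u" for i j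
    using h U u cfp unfolding hessian_metric_def f_def[abs_def] by metis
  have conn: "\<Gamma> p (dx u (axis i 1)) (dx u (axis j 1)) $ last_index
      = - partial_deriv i (partial_deriv j f) u" for i j
  proof -
    \<comment> \<open>On the chart \<open>coord_field x U j\<close> is \<open>X\<close> composed
      with the local inverse \<open>g\<close>, so its derivative along the i-th frame vector is the
      i-th partial derivative of \<open>X\<close>.\<close>
    define X where "X u = dx u (axis j 1)" for u
    have pX: "complex_polynomial_function (\<lambda>u. X u $ \<alpha>)" for \<alpha>
      unfolding X_def dx_def complex_polynomial_map_has_derivative(2)[OF px]
      by (rule complex_polynomial_function_frechet[OF px])
    have "((\<lambda>q. X (g q)) has_derivative (\<lambda>v. frechet_derivative X (at u) (g' p v))) (at p)"
      using diff_chain_at[OF g(1)[OF p], of X "frechet_derivative X (at u)"] g(2)[OF u(1)] u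
        complex_polynomial_map_has_derivative(1)[OF pX, of u]
      by (simp add: o_def)
    then have "(coord_field x U j has_derivative (\<lambda>v. frechet_derivative X (at u) (g' p v))) (at p)"
      by (rule has_derivative_transform_within_open[OF _ U(4) p]) (simp add: cf X_def)
    then have "frechet_derivative (coord_field x U j) (at p) (dx u (axis i 1))
        = frechet_derivative X (at u) (axis i 1)"
      using frechet_derivative_at g'_dx by metis
    moreover have "cov_deriv \<Gamma> (coord_field x U i) (coord_field x U j) p = 0"
      using \<Gamma> U p unfolding linear_connection_on_orbits_def by blast
    ultimately have "frechet_derivative X (at u) (axis i 1)
        + \<Gamma> p (dx u (axis i 1)) (dx u (axis j 1)) = 0"
      by (simp add: cov_deriv_def cfp)
    then have "\<Gamma> p (dx u (axis i 1)) (dx u (axis j 1)) = - frechet_derivative X (at u) (axis i 1)"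
      by (simp add: add_eq_0_iff)
    moreover have "frechet_derivative X (at u) (axis i 1) $ last_index
        = frechet_derivative (\<lambda>u. X u $ last_index) (at u) (axis i 1)"
      by (rule complex_polynomial_map_has_derivative(2)[OF pX])
    moreover have "(\<lambda>u. X u $ last_index) = partial_deriv j f"
      by (simp add: X_def dx_f partial_deriv_def fun_eq_iff)
    ultimately show ?thesis by (simp add: partial_deriv_def[of i])
  qed
  have hm: "metric_on (x ` regular_vectors G) h" using h by (simp add: hessian_metric_def)
  have \<Gamma>t: "tensor21_on (x ` regular_vectors G) \<Gamma>"
    using \<Gamma> by (simp add: linear_connection_on_orbits_def)
  have neg: "Vector_Spaces.linear (*s) (*) (\<lambda>w. - k w)"
    if "Vector_Spaces.linear (*s) (*) k" for k :: "'n cvec \<Rightarrow> complex"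
    using linear_scalarD[OF that] that
    by (auto simp: Vector_Spaces.linear_def module_hom_def module_hom_axioms_def)
  show "h p v w = - \<Gamma> p v w $ last_index" for v w
    by (rule bilinear_forms_eqI[OF lin bij_u])
      (simp_all only: metric_onD[OF hm pS] neg tensor21_component_linear[OF \<Gamma>t pS]
        hess conn minus_minus)
  have d1: "d first_index \<noteq> 0"
    using basic_invariants_degree_pos[OF x bij[OF u(1)]] by (metis less_irrefl)
  have E: "euler_field d p = (1 / of_nat (d first_index)) *s dx u u"
    using basic_invariants_euler_identity[OF x, of u]
    by (simp add: euler_field_def vec_eq_iff u(2) dx_def)
  have euler_f: "(\<Sum>j\<in>UNIV. u $ j * partial_deriv j f u) = of_nat (d last_index) * f u" for u
  proof -
    have "dx u u $ last_index = (\<Sum>j\<in>UNIV. u $ j * dx u (axis j 1) $ last_index)"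
      by (rule linear_compose_sum_axis[OF lin linear_vec_nth])
    then show ?thesis
      using basic_invariants_euler_identity[OF x, of u last_index]
      by (simp add: dx_f[symmetric] partial_deriv_def f_def flip: dx_def)
  qed
  \<comment> \<open>Differentiating Euler's identity for \<open>f\<close> in direction
    \<open>i\<close> produces one extra first derivative, hence the \<open>- 1\<close>.\<close>
  have second: "(\<Sum>j\<in>UNIV. u $ j * partial_deriv i (partial_deriv j f) u)
      = (of_nat (d last_index) - 1) * partial_deriv i f u" for i
  proof -
    have pp: "(partial_deriv j f has_derivative frechet_derivative (partial_deriv j f) (at u)) (at u)" for j
      unfolding partial_deriv_def[abs_def]
      by (intro complex_polynomial_function_has_derivative complex_polynomial_function_frechet pf)
    have 1: "((\<lambda>u. \<Sum>j\<in>UNIV. u $ j * partial_deriv j f u) has_derivative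
      (\<lambda>v. \<Sum>j\<in>UNIV. u $ j * frechet_derivative (partial_deriv j f) (at u) v
        + v $ j * partial_deriv j f u)) (at u)"
      by (intro has_derivative_sum has_derivative_mult pp bounded_linear_imp_has_derivative
          bounded_linear_vec_nth)
    have 2: "((\<lambda>u. \<Sum>j\<in>UNIV. u $ j * partial_deriv j f u) has_derivative
      (\<lambda>v. of_nat (d last_index) * frechet_derivative f (at u) v)) (at u)"
      unfolding euler_f
      by (intro has_derivative_mult_right complex_polynomial_function_has_derivative pf)
    have "(\<Sum>j\<in>UNIV. u $ j * frechet_derivative (partial_deriv j f) (at u) (axis i 1)
        + axis i 1 $ j * partial_deriv j f u)
      = of_nat (d last_index) * frechet_derivative f (at u) (axis i 1)"
      by (rule fun_cong[OF has_derivative_unique[OF 1 2]])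
    then have "(\<Sum>j\<in>UNIV. u $ j * partial_deriv i (partial_deriv j f) u) + partial_deriv i f u
      = of_nat (d last_index) * partial_deriv i f u"
      by (simp add: sum.distrib axis_def if_distrib[of "\<lambda>c. c * _"] partial_deriv_def[of i]
          cong: if_cong)
    then show ?thesis by (simp add: algebra_simps)
  qed
  show "h p v (euler_field d p)
      = (of_nat (d last_index) - 1) / of_nat (d first_index) * v $ last_index" for v
  proof -
    obtain a where a: "v = dx u a" using bij_u by (metis bij_pointE)
    have *: "h p (dx u (axis i 1)) (dx u u)
        = (\<Sum>j\<in>UNIV. u $ j * partial_deriv i (partial_deriv j f) u)" for i
      unfolding hess[symmetric] by (rule linear_compose_sum_axis[OF lin metric_onD(1)[OF hm pS]])
    have "h p (dx u a) (dx u u) = (\<Sum>i\<in>UNIV. a $ i * h p (dx u (axis i 1)) (dx u u))"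
      by (rule linear_compose_sum_axis[OF lin metric_onD(3)[OF hm pS]])
    also have "\<dots>
        = (of_nat (d last_index) - 1) * (\<Sum>i\<in>UNIV. a $ i * dx u (axis i 1) $ last_index)"
      unfolding * second by (simp add: dx_f sum_distrib_left partial_deriv_def mult_ac)
    also have "(\<Sum>i\<in>UNIV. a $ i * dx u (axis i 1) $ last_index) = v $ last_index"
      unfolding a by (rule linear_compose_sum_axis[OF lin linear_vec_nth, symmetric])
    finally show ?thesis
      using d1 by (simp add: E a metric_on_simps[OF hm pS])
  qed
qed

lemma obtained_by_duality_onD:
  assumes "obtained_by_duality_on S \<Gamma>' unit_field \<Gamma> m" "open W" "W \<subseteq> S" "p \<in> W"
  shows "\<Gamma> p v w = \<Gamma>' p v w - \<Gamma>' p (m p v w) (axis first_index 1)"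
proof -
  have "cov_deriv \<Gamma> (\<lambda>_. v) (\<lambda>_. w) p = cov_deriv \<Gamma>' (\<lambda>_. v) (\<lambda>_. w) p
      - cov_deriv \<Gamma>' (times_field m (\<lambda>_. v) (\<lambda>_. w)) unit_field p"
    using assms(1)[unfolded obtained_by_duality_on_def] assms(2-4)
    by (elim conjE exE) (drule spec[of _ W], drule spec[of _ W], drule spec[of _ "\<lambda>_. v"],
      drule spec[of _ "\<lambda>_. v"], drule spec[of _ "\<lambda>_. w"], drule spec[of _ "\<lambda>_. w"], simp)
  then show ?thesis
    by (simp add: cov_deriv_const_right unit_field_const times_field_def)
qed

text \<open>If the last coordinate is \<open>\<nabla>\<close>-flat, duality makes \<open>h p v w\<close> a function of the product
  \<open>m p v w\<close> alone, so that the Euler field can be moved to the right argument of \<open>h\<close>.\<close>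

lemma hessian_metric_mul_euler:
  assumes S: "saito_structure_on UNIV \<Gamma> m unit_field (euler_field d)"
    and dual: "obtained_by_duality_on S \<Gamma>' unit_field \<Gamma> m" "open W" "W \<subseteq> S" "p \<in> W"
    and flat: "\<And>v w. \<Gamma> p v w $ last_index = 0"
    and h: "\<And>v w. h p v w = - \<Gamma>' p v w $ last_index"
      "\<And>v. h p v (euler_field d p) = \<kappa> * v $ last_index"
  shows "h p (m p (euler_field d p) v) w = \<kappa> * m p v w $ last_index"
proof -
  have *: "h p v w = - \<Gamma>' p (m p v w) (axis first_index 1) $ last_index" for v w
    using flat[of v w] obtained_by_duality_onD[OF dual, of v w] by (simp add: h(1))
  have "m p (m p (euler_field d p) v) w = m p (m p v w) (euler_field d p)"
    using saito_structure_onD(4,5)[OF S] by metis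
  then have "h p (m p (euler_field d p) v) w = h p (m p v w) (euler_field d p)"
    by (simp only: *)
  then show ?thesis by (simp only: h(2))
qed

text \<open>Translation by \<open>r\<close> along the unit field fixes the two right-hand sides and shifts both
  multiplications by \<open>E\<close> by \<open>r\<close>; comparing \<open>h\<close> at the two points isolates
  \<open>r\<close> times the difference of the multiplications.\<close>

lemma euler_multiplication_unique:
  assumes S: "saito_structure_on UNIV \<Gamma> m unit_field (euler_field d)"
    and S': "saito_structure_on UNIV \<Gamma>' m' unit_field (euler_field d)"
    and d: "d first_index \<noteq> 0"
    and W: "metric_on S h" "W \<subseteq> S" "open W" "p \<in> W"
    and h: "\<And>q v w. q \<in> W \<Longrightarrow> h q (m q (euler_field d q) v) w = \<kappa> * m q v w $ i"
    and h': "\<And>q v w. q \<in> W \<Longrightarrow> h q (m' q (euler_field d q) v) w = \<kappa>' * m' q v w $ i"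
  shows "m p (euler_field d p) v = m' p (euler_field d p) v"
proof -
  define M where "M v = m p (euler_field d p) v" for v
  define a where "a = M v - m' p (euler_field d p) v"
  define c where "c r = p + r *\<^sub>R axis first_index (1 :: complex)" for r
  have "continuous_on UNIV c" unfolding c_def by (intro continuous_intros)
  then have "open (c -` W)" using W(3) open_vimage by blast
  moreover have "0 \<in> c -` W" using W(4) by (simp add: c_def)
  ultimately obtain \<epsilon> where \<epsilon>: "\<epsilon> > 0" "ball 0 \<epsilon> \<subseteq> c -` W" using open_contains_ball by blast
  define r where "r = \<epsilon> / 2"
  have r: "r \<noteq> 0" using \<epsilon> by (simp add: r_def)
  have cr: "c r \<in> W" using \<epsilon> by (auto simp: r_def subset_iff)
  have pS: "p \<in> S" "c r \<in> S" using W cr by auto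
  note hp = metric_on_simps[OF W(1) pS(1)] metric_onD(2)[OF W(1) pS(1)]
  note hc = metric_on_simps[OF W(1) pS(2)] metric_onD(2)[OF W(1) pS(2)]
  have shift: "h (c r) (M v + r *\<^sub>R v) w = h p (M v) w" for v w
    using h[OF cr, of v w] h[OF W(4), of v w] saito_mul_unit_translate[OF S, of p r]
      saito_mul_euler_translate[OF S d, of p r]
    by (simp add: M_def c_def)
  have shift': "h (c r) (m' p (euler_field d p) v + r *\<^sub>R v) w = h p (m' p (euler_field d p) v) w" for v w
    using h'[OF cr, of v w] h'[OF W(4), of v w] saito_mul_unit_translate[OF S', of p r]
      saito_mul_euler_translate[OF S' d, of p r]
    by (simp add: c_def)
  \<comment> \<open>In the difference of \<open>shift\<close> and \<open>shift'\<close> the terms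
    with \<open>r *\<^sub>R v\<close> cancel.\<close>
  have ha: "h (c r) a w = h p a w" for w
  proof -
    have "h (c r) (M v) w + h (c r) (r *\<^sub>R v) w = h p (M v) w"
      using shift[of v w] by (simp only: hc(1))
    moreover have "h (c r) (m' p (euler_field d p) v) w + h (c r) (r *\<^sub>R v) w
        = h p (m' p (euler_field d p) v) w"
      using shift'[of v w] by (simp only: hc(1))
    ultimately show ?thesis unfolding a_def hp(3) hc(3) by (metis add_diff_cancel_right)
  qed
  \<comment> \<open>Pair \<open>shift\<close> with \<open>a\<close>: by \<open>ha\<close> its left
    side may be evaluated at \<open>p\<close>, where it exceeds the right side by \<open>r\<close>
    times \<open>h p a w\<close>.\<close>
  have "h p a w = 0" for w
  proof -
    have sc: "r *\<^sub>R w = of_real r *s w"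
      by (simp add: vec_eq_iff scaleR_conv_of_real[where 'a=complex])
    have "h p a (M w) + of_real r * h p a w = h p a (M w + r *\<^sub>R w)"
      by (simp add: hp(2,6) sc)
    also have "\<dots> = h (c r) (M w + r *\<^sub>R w) a" by (metis ha hc(11))
    also have "\<dots> = h p a (M w)" using shift hp(11) by metis
    finally show ?thesis using r by simp
  qed
  then have "a = 0" by (rule metric_on_nondegenerate[OF W(1) pS(1)])
  then show ?thesis by (simp add: a_def M_def)
qed

text \<open>Paired with \<open>g\<close>, the difference \<open>T\<close> of the two symbols gives a
  trilinear form symmetric in one pair of arguments and skew in another. Alternating the two
  symmetries returns to the start after three sign changes, so the form is zero.\<close>

lemma levi_civita_unique:
  assumes g: "metric_on UNIV g"
    and c: "\<And>p u v w. frechet_derivative (\<lambda>p. g p v w) (at p) u = g p (\<Gamma> p u v) w + g p v (\<Gamma> p u w)"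
      "\<And>p u v w. frechet_derivative (\<lambda>p. g p v w) (at p) u = g p (\<Gamma>' p u v) w + g p v (\<Gamma>' p u w)"
    and s: "\<And>p v w. \<Gamma> p v w = \<Gamma> p w v" "\<And>p v w. \<Gamma>' p v w = \<Gamma>' p w v"
  shows "\<Gamma> = \<Gamma>'"
proof (intro ext)
  fix p v w
  define T where "T u v = \<Gamma> p u v - \<Gamma>' p u v" for u v
  note gs = metric_on_simps[OF g UNIV_I, of p]
  have Ts: "T u v = T v u" for u v using s by (simp add: T_def)
  have skew: "g p (T u v) w = - g p (T u w) v" for u v w
    using c(1)[of v w p u] c(2)[of v w p u] metric_onD(2)[OF g UNIV_I, of p v]
    by (simp add: T_def gs algebra_simps)
  have "g p (T u v) w = - g p (T u v) w" for u v w
    by (metis skew[of u v w] skew[of w u v] skew[of v w u] Ts[of u w] Ts[of v w] Ts[of u v]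
        minus_minus)
  then have "T v w = 0"
    using metric_on_nondegenerate[OF g UNIV_I, of p "T v w"] by (simp add: equal_neg_zero)
  then show "\<Gamma> p v w = \<Gamma>' p v w" by (simp add: T_def)
qed

text \<open>On a chart both products with the Euler field satisfy an equation of the same shape with
  respect to \<open>h\<close>, hence agree. The resulting formula for \<open>\<eta>\<close> involves
  only functions holomorphic on the whole orbit space and extends there.\<close>

lemma coxeter_shephard_comparison:
  fixes x :: "'n::{finite,linorder} cvec \<Rightarrow> 'n cvec"
  assumes G: "finite_reflection_group G" and x: "basic_invariants G x d"
    and d1: "\<forall>\<alpha>. \<alpha> \<noteq> first_index \<longrightarrow> d \<alpha> < d first_index"
    and N: "natural_saito_structure G x d \<Gamma> m"
    and C: "coxeter_shephard_frobenius_structure G x d \<Gamma>' m' \<eta>"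
    and flat: "\<And>p v w. \<Gamma> p v w $ last_index = 0"
  shows "\<exists>\<kappa>. \<forall>p v w. \<eta> p v w = \<kappa> * m p v w $ last_index"
proof -
  obtain U g g' where U: "open U" "U \<noteq> {}" "U \<subseteq> regular_vectors G" "inj_on x U" "open (x ` U)"
    and g: "\<And>p. p \<in> x ` U \<Longrightarrow> (g has_derivative g' p) (at p)" "\<And>u. u \<in> U \<Longrightarrow> g (x u) = u"
    and bij: "\<And>u. u \<in> U \<Longrightarrow> bij (frechet_derivative x (at u))"
    using orbit_map_chart[of G x d] G x unfolding finite_reflection_group_def by blast
  obtain u where "u \<in> U" using U(2) by blast
  note d0 = basic_invariants_degree_pos[OF x bij[OF this]]
  have "d first_index \<noteq> 0" using d0[of first_index] by simp
  obtain \<Gamma>V where S: "saito_structure_on UNIV \<Gamma> m unit_field (euler_field d)"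
    and \<Gamma>V: "linear_connection_on_orbits G x \<Gamma>V"
      "obtained_by_duality_on (x ` regular_vectors G) \<Gamma>V unit_field \<Gamma> m"
    using N unfolding natural_saito_structure_def by blast
  obtain D h where F: "frobenius_structure_on UNIV \<Gamma>' m' unit_field (euler_field d) D \<eta>"
    and h: "hessian_metric G x h"
      "\<forall>p\<in>x ` regular_vectors G. \<forall>v w. \<eta> p v w = h p v (m' p (euler_field d p) w)"
    using C unfolding coxeter_shephard_frobenius_structure_def by blast
  have hm: "metric_on (x ` regular_vectors G) h" using h(1) by (simp add: hessian_metric_def)
  note S' = frobenius_structure_onD(1)[OF F]
  have "antimono d" using x by (simp add: basic_invariants_def)
  from frobenius_charge_and_covector(2)[OF F this d0 d1]
  obtain c where c: "c \<noteq> 0" "\<And>p v. \<eta> p (axis first_index 1) v = c * v $ last_index"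
    by blast
  have xU: "x ` U \<subseteq> x ` regular_vectors G" using U(3) by (rule image_mono)
  \<comment> \<open>This is the factor in \<open>h p v (euler_field d p)\<close> supplied by Euler's
    identity.\<close>
  define \<kappa> where "\<kappa> = (of_nat (d last_index) - 1 :: complex) / of_nat (d first_index)"
  have hE: "h q (m q (euler_field d q) v) w = \<kappa> * m q v w $ last_index" if "q \<in> x ` U" for q v w
    unfolding \<kappa>_def
    by (rule hessian_metric_mul_euler[OF S \<Gamma>V(2) U(5) xU that flat];
        rule hessian_metric_christoffel[OF x h(1) \<Gamma>V(1) U(1,3,4,5) g bij that]; assumption)
  have hE': "h q (m' q (euler_field d q) v) w = \<eta> q v w" if "q \<in> x ` U" for q v w
  proof -
    have q: "q \<in> x ` regular_vectors G" using that xU by blast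
    have "h q (m' q (euler_field d q) v) w = \<eta> q w v"
      using bspec[OF h(2) q] metric_onD(2)[OF hm q] by simp
    then show ?thesis
      using metric_onD(2)[OF frobenius_structure_onD(2)[OF F] UNIV_I] by metis
  qed
  have on_chart: "\<eta> q v w = \<kappa> * m q v w $ last_index" if "q \<in> x ` U" for q v w
    \<comment> \<open>The second multiplication enters with the factor \<open>c\<close>, since
      \<open>\<eta>\<close> is \<open>c\<close> times the last component of its own product.\<close>
    using euler_multiplication_unique[OF S S' \<open>d first_index \<noteq> 0\<close> hm xU U(5) that hE, of c v]
      hE' hE[OF that, of v w] hE'[OF that, of v w] frobenius_last_christoffel(2)[OF F c] by simp
  have "\<eta> p v w = \<kappa> * m p v w $ last_index" for p v w
  proof (rule holomorphic_fun_on_identity[of "\<lambda>p. \<eta> p v w" "\<lambda>p. \<kappa> * m p v w $ last_index" "x ` U" p])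
    show "holomorphic_fun_on UNIV (\<lambda>p. \<eta> p v w)"
      by (rule metric_on_holomorphic[OF frobenius_structure_onD(2)[OF F]])
    show "holomorphic_fun_on UNIV (\<lambda>p. \<kappa> * m p v w $ last_index)"
      using tensor21_onD(3)[OF saito_structure_onD(3)[OF S] UNIV_I, of v w]
      by (intro holomorphic_fun_on_cmult) (simp add: vector_field_on_def)
  qed (use U(2,5) on_chart in auto)
  then show ?thesis by blast
qed

theorem theorem5p5:
  fixes G :: "'n::{finite,linorder} cmat set"
    and x :: "'n cvec \<Rightarrow> 'n cvec"
    and d :: "'n \<Rightarrow> nat"
    and nabla nabla_cs mul mul_cs :: "'n tensor21"
    and \<eta> :: "'n tensor20"
  assumes "finite_reflection_group G" and "irreducible_group G"
    and "finite_coxeter_group G \<or> shephard_group G"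
    and "basic_invariants G x d"
    and "\<forall>\<alpha>. \<alpha> \<noteq> first_index \<longrightarrow> d \<alpha> < d first_index"
    and "natural_saito_structure G x d nabla mul"
    and "coxeter_shephard_frobenius_structure G x d nabla_cs mul_cs \<eta>"
  shows "((\<exists>g D. frobenius_structure_on UNIV nabla mul unit_field (euler_field d) D g)
            \<longleftrightarrow> nabla = nabla_cs) \<and>
         (\<forall>g D. frobenius_structure_on UNIV nabla mul unit_field (euler_field d) D g \<longrightarrow>
            (\<exists>c. \<forall>p v w. g p v w = c * \<eta> p v w) \<and>
            D = 1 - of_nat (d last_index) / of_nat (d first_index))"
proof -
  obtain D' where F': "frobenius_structure_on UNIV nabla_cs mul_cs unit_field (euler_field d) D' \<eta>"
    using assms(7) unfolding coxeter_shephard_frobenius_structure_def by blast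
  have S: "saito_structure_on UNIV nabla mul unit_field (euler_field d)"
    using assms(6) by (simp add: natural_saito_structure_def)
  have d: "antimono d" using assms(4) by (simp add: basic_invariants_def)
  obtain U g g' where "U \<noteq> {}" "\<And>u. u \<in> U \<Longrightarrow> bij (frechet_derivative x (at u))"
    using orbit_map_chart[of G x d] assms(1,4) unfolding finite_reflection_group_def by metis
  then have d0: "\<And>\<alpha>. d \<alpha> > 0"
    using basic_invariants_degree_pos[OF assms(4)] by blast
  note compare = coxeter_shephard_comparison[OF assms(1,4) assms(5-7)]
  have unique: "(\<exists>c. \<forall>p v w. g p v w = c * \<eta> p v w) \<and>
      D = 1 - of_nat (d last_index) / of_nat (d first_index) \<and> nabla = nabla_cs"
    if F: "frobenius_structure_on UNIV nabla mul unit_field (euler_field d) D g" for g D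
  proof -
    note D = frobenius_charge_and_covector(1)[OF F d d0 assms(5)]
    obtain c where c: "c \<noteq> 0" "\<And>p v. g p (axis first_index 1) v = c * v $ last_index"
      using frobenius_charge_and_covector(2)[OF F d d0 assms(5)] by blast
    obtain \<kappa> where \<kappa>: "\<And>p v w. \<eta> p v w = \<kappa> * mul p v w $ last_index"
      using compare[OF frobenius_last_christoffel(1)[OF F c]] by blast
    have g\<eta>: "\<eta> p v w = \<kappa> / c * g p v w" for p v w
      using c(1) by (simp add: \<kappa> frobenius_last_christoffel(2)[OF F c])
    \<comment> \<open>Otherwise \<open>\<eta>\<close> would vanish identically and be
      degenerate.\<close>
    have "\<kappa> \<noteq> 0"
      using metric_on_nondegenerate[OF frobenius_structure_onD(2)[OF F'] UNIV_I, of 0 "axis first_index 1"]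
      by (auto simp: \<kappa> axis_eq_0_iff)
    then have "g p v w = c / \<kappa> * \<eta> p v w" for p v w
      using c(1) by (simp add: g\<eta>)
    \<comment> \<open>As a constant multiple of \<open>g\<close>, the metric \<open>\<eta>\<close>
      is preserved by \<open>nabla\<close> too, so both connections are its Levi-Civita
      connection.\<close>
    moreover have "nabla = nabla_cs"
    proof (rule levi_civita_unique[OF frobenius_structure_onD(2)[OF F']])
      fix p u v w
      show "frechet_derivative (\<lambda>p. \<eta> p v w) (at p) u
          = \<eta> p (nabla_cs p u v) w + \<eta> p v (nabla_cs p u w)"
        by (rule metric_connection_const[OF frobenius_structure_onD(3)[OF F']])
      have "((\<lambda>p. \<eta> p v w) has_derivative
          (\<lambda>u. \<kappa> / c * frechet_derivative (\<lambda>p. g p v w) (at p) u)) (at p)"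
        unfolding g\<eta>
        by (intro has_derivative_mult_right holomorphic_fun_onD(1)[OF
              metric_on_holomorphic[OF frobenius_structure_onD(2)[OF F]] UNIV_I])
      then have "frechet_derivative (\<lambda>p. \<eta> p v w) (at p) u
          = \<kappa> / c * frechet_derivative (\<lambda>p. g p v w) (at p) u"
        by (simp only: frechet_derivative_at[symmetric])
      then show "frechet_derivative (\<lambda>p. \<eta> p v w) (at p) u
          = \<eta> p (nabla p u v) w + \<eta> p v (nabla p u w)"
        by (simp only: metric_connection_const[OF frobenius_structure_onD(3)[OF F]] g\<eta> distrib_left)
    qed (rule saito_structure_onD(2)[OF S] saito_structure_onD(2)[OF frobenius_structure_onD(1)[OF F']])+
    ultimately show ?thesis using D by blast
  qed
  \<comment> \<open>The metric sought is \<open>\<eta>\<close> itself, with the charge it already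
    has: equality of the connections carries over metricity, and the homogeneity condition does not
    involve the multiplication.\<close>
  moreover have "\<exists>g D. frobenius_structure_on UNIV nabla mul unit_field (euler_field d) D g"
    if eq: "nabla = nabla_cs"
  proof -
    obtain c where c: "c \<noteq> 0" "\<And>p v. \<eta> p (axis first_index 1) v = c * v $ last_index"
      using frobenius_charge_and_covector(2)[OF F' d d0 assms(5)] by blast
    obtain \<kappa> where \<kappa>: "\<And>p v w. \<eta> p v w = \<kappa> * mul p v w $ last_index"
      using compare[OF frobenius_last_christoffel(1)[OF F' c, folded eq]] by blast
    \<comment> \<open>Both sides are \<open>\<kappa>\<close> times the last component of the triple
      product, so associativity gives invariance.\<close>
    have "\<eta> p (mul p u v) w = \<eta> p u (mul p v w)" for p u v w
      by (simp add: \<kappa> saito_structure_onD(4)[OF S])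
    then have "frobenius_structure_on UNIV nabla mul unit_field (euler_field d) D' \<eta>"
      using F' S eq unfolding frobenius_structure_on_def
      by (simp add: eval_metric_def times_field_def)
    then show ?thesis by blast
  qed
  ultimately show ?thesis by blast
qed

end
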